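(* Let $(i,j)\in\mathbb{Z}^2\setminus\mathcal H$. There exist Laurent polynomials $f(z)$ with coefficients in $\mathbb{Q}$ and $g(z)$ with coefficients in $\mathbb{Q}[\sqrt2]$, with $f(1)=1$ and $g(1)\ne0$, such that $$\sum_{k\ge0}p^{[k]}_{i,j}z^k=f(z)-g(z)\sqrt{(1-z)\left(1-z(\sqrt2-1)^2\right)}.$$ Consequently, as $k\to\infty$, $$p^{[k]}_{i,j}\sim g(1)\sqrt{\frac{\sqrt2-1}{2\pi}}\,k^{-3/2},\qquad \sum_{\ell\ge k}p^{[\ell]}_{i,j}\sim g(1)\sqrt{\frac{2(\sqrt2-1)}{\pi}}\,k^{-1/2}.$$ For $(i,j)=(1,0)$ one has $f(z)=g(z)=1/z$ (so $g(1)=1$).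
   Context: $\mathcal H=\{(k,0):k\in\mathbb{Z},k\le0\}$. Let $(W_n)_{n\ge0}$ be the simple random walk on $\mathbb{Z}^2$ (each step uniform in $\{(\pm1,0),(0,\pm1)\}$) started at $W_0=(i,j)\notin\mathcal H$, and $\tau=\min\{n\ge0:W_n\in\mathcal H\}$ (finite almost surely). $p^{[k]}_{i,j}=\Pr(W_\tau=(-k,0))$ for $k\ge0$. The square root is the branch equal to $1$ at $z=0$, and the series converges for $|z|\le1$. *)

theory Defs
  imports "HOL-Analysis.Analysis" "HOL-Computational_Algebra.Polynomial" "HOL-Library.Landau_Symbols"
begin

definition Hset :: "(int \<times> int) set" where
  "Hset = {(k, 0) | k. k \<le> 0}"

text \<open>first_hit n s t = Pr(tau = n and W_tau = t) for the simple random walk started at s,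
  where tau is the first hitting time of Hset (first-step decomposition).\<close>
fun first_hit :: "nat \<Rightarrow> int \<times> int \<Rightarrow> int \<times> int \<Rightarrow> real" where
  "first_hit 0 s t = (if s \<in> Hset \<and> s = t then 1 else 0)"
| "first_hit (Suc n) s t =
     (if s \<in> Hset then 0
      else (first_hit n (fst s + 1, snd s) t + first_hit n (fst s - 1, snd s) t
          + first_hit n (fst s, snd s + 1) t + first_hit n (fst s, snd s - 1) t) / 4)"

text \<open>p^[k]_{i,j} = Pr(W_tau = (-k,0)) = sum over n of Pr(tau = n, W_n = (-k,0)).\<close>
definition hitp :: "int \<Rightarrow> int \<Rightarrow> nat \<Rightarrow> real" where
  "hitp i j k = (\<Sum>n. first_hit n (i, j) (- int k, 0))"

definition laurent_eval :: "int \<Rightarrow> real poly \<Rightarrow> 'a::real_normed_field \<Rightarrow> 'a" where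
  "laurent_eval m P z = poly (map_poly of_real P) z * z powi m"

definition QSqrt2 :: "real set" where
  "QSqrt2 = {of_rat a + of_rat b * sqrt 2 | a b. True}"

end

theory Submission
  imports Defs "HOL-Computational_Algebra.Formal_Laurent_Series"
    "HOL-Complex_Analysis.Cauchy_Integral_Formula"
    "HOL-Real_Asymp.Real_Asymp"
begin

text \<open>
  Write \<open>S(z) = \<surd>((1 - z)(1 - \<alpha>z))\<close> with \<open>\<alpha> = (\<surd>2 - 1)\<^sup>2\<close>. A bounded function that is harmonic off the slit
  is determined in each half-plane by its values on the axis, through the discrete Poisson kernel. On the
  axis, harmonicity is therefore a convolution equation for the trace of the walk, whose step law \<open>p\<close>
  satisfies
  \<open>1 - \<Sum>\<^sub>k p(k) w\<^sup>k = \<surd>((4 - w - 1/w)\<^sup>2 - 4) / 4 = (\<surd>2 + 1) / 4 S(w) S(1/w)\<close> for \<open>|w| = 1\<close>. This Wiener--Hopf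
  factorisation solves the equation explicitly: the generating function of the walk started at \<open>(m, 0)\<close> is
  \<open>S(x)\<close> times the coefficient of \<open>w\<^sup>m\<close> in \<open>1 / (S(w) (1 - x/w))\<close>. It yields the row \<open>j = 0\<close> and, through the
  value of the convolution at \<open>m \<le> 0\<close>, the row \<open>j = 1\<close>; harmonicity gives the other rows, all of the form
  \<open>f - g S\<close>. The numbers \<open>g(1)\<close> form a nonnegative function that is harmonic off the slit and takes the
  value 1 at \<open>(1, 0)\<close>, hence it does not vanish there.
\<close>

unbundle no vec_syntax
unbundle fps_syntax


section \<open>Absolutely convergent power series\<close>

definition fps_abs_conv :: "real fps \<Rightarrow> 'a::{real_normed_field, banach} \<Rightarrow> bool" where
  "fps_abs_conv f z \<longleftrightarrow> summable (\<lambda>n. norm (of_real (f $ n) * z ^ n))"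

definition fps_value :: "real fps \<Rightarrow> 'a \<Rightarrow> 'a::{real_normed_field, banach}" where
  "fps_value f z = (\<Sum>n. of_real (f $ n) * z ^ n)"

lemma fps_value_sums: "fps_abs_conv f z \<Longrightarrow> (\<lambda>n. of_real (f $ n) * z ^ n) sums fps_value f z"
  unfolding fps_abs_conv_def fps_value_def by (rule summable_sums[OF summable_norm_cancel])

lemma fps_value_real_sums:
  fixes x :: real
  assumes "fps_abs_conv f x"
  shows "(\<lambda>n. f $ n * x ^ n) sums fps_value f x"
  using fps_value_sums[OF assms] by simp

lemma fps_abs_conv_1_iff: "fps_abs_conv f (1 :: 'a::{real_normed_field, banach}) \<longleftrightarrow> summable (\<lambda>n. \<bar>f $ n\<bar>)"
  by (simp add: fps_abs_conv_def)

lemma fps_abs_conv_mono: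
  assumes "fps_abs_conv f w" "norm z \<le> norm w"
  shows "fps_abs_conv f z"
  unfolding fps_abs_conv_def
proof (rule summable_comparison_test')
  show "summable (\<lambda>n. norm (of_real (f $ n) * w ^ n))"
    using assms(1) by (simp add: fps_abs_conv_def)
  show "norm (norm (of_real (f $ n) * z ^ n)) \<le> norm (of_real (f $ n) * w ^ n)" for n
    using assms(2) by (simp add: norm_mult norm_power mult_left_mono power_mono)
qed

lemma fps_abs_conv_diff:
  assumes "fps_abs_conv f z" "fps_abs_conv g z"
  shows "fps_abs_conv (f - g) z"
  unfolding fps_abs_conv_def
proof (rule summable_comparison_test')
  show "summable (\<lambda>n. norm (of_real (f $ n) * z ^ n) + norm (of_real (g $ n) * z ^ n))"
    using assms by (intro summable_add) (simp_all add: fps_abs_conv_def)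
  show "norm (norm (of_real ((f - g) $ n) * z ^ n))
      \<le> norm (of_real (f $ n) * z ^ n) + norm (of_real (g $ n) * z ^ n)" for n
    by (simp add: left_diff_distrib norm_triangle_ineq4)
qed

lemma fps_value_diff:
  assumes "fps_abs_conv f z" "fps_abs_conv g z"
  shows "fps_value (f - g) z = fps_value f z - fps_value g z"
  using sums_diff[OF assms[THEN fps_value_sums]]
  by (simp add: fps_value_def[of "f - g"] left_diff_distrib sums_iff)

lemma fps_mult_nth_power:
  fixes z :: "'a::{real_normed_field, banach}"
  shows "of_real ((f * g) $ n) * z ^ n
    = (\<Sum>i\<le>n. (of_real (f $ i) * z ^ i) * (of_real (g $ (n - i)) * z ^ (n - i)))"
proof -
  have "of_real (f $ i * g $ (n - i)) * z ^ n
    = (of_real (f $ i) * z ^ i) * (of_real (g $ (n - i)) * z ^ (n - i))"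
    if "i \<le> n" for i
  proof -
    have "z ^ n = z ^ i * z ^ (n - i)" using that by (simp flip: power_add)
    then show ?thesis by (simp add: mult_ac)
  qed
  then show ?thesis
    unfolding fps_mult_nth of_real_sum sum_distrib_right atLeast0AtMost by (intro sum.cong) auto
qed

lemma fps_abs_conv_mult:
  fixes z :: "'a::{real_normed_field, banach}"
  assumes "fps_abs_conv f z" "fps_abs_conv g z"
  shows "fps_abs_conv (f * g) z"
  unfolding fps_abs_conv_def
proof (rule summable_comparison_test')
  define a b where "a n = norm (of_real (f $ n) * z ^ n)" and "b n = norm (of_real (g $ n) * z ^ n)" for n
  show "summable (\<lambda>n. \<Sum>i\<le>n. a i * b (n - i))"
    using assms by (intro summable_Cauchy_product) (simp_all add: fps_abs_conv_def a_def b_def)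
  show "norm (norm (of_real ((f * g) $ n) * z ^ n)) \<le> (\<Sum>i\<le>n. a i * b (n - i))" for n
    unfolding fps_mult_nth_power a_def b_def norm_mult[symmetric] real_norm_def abs_norm_cancel
    by (rule norm_sum)
qed

lemma fps_value_mult:
  assumes "fps_abs_conv f z" "fps_abs_conv g z"
  shows "fps_value (f * g) z = fps_value f z * fps_value g z"
  using Cauchy_product_sums[OF assms[unfolded fps_abs_conv_def]]
  by (simp add: fps_value_def fps_mult_nth_power sums_iff)

lemma fps_abs_conv_of_poly: "fps_abs_conv (fps_of_poly p) z"
  unfolding fps_abs_conv_def by (rule summable_finite[of "{..degree p}"]) (auto simp: coeff_eq_0)

lemma fps_value_of_poly: "fps_value (fps_of_poly p) z = poly (map_poly of_real p) z"
proof -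
  have "fps_value (fps_of_poly p) z = (\<Sum>n\<le>degree p. of_real (coeff p n) * z ^ n)"
    unfolding fps_value_def by (subst suminf_finite[of "{..degree p}"]) (auto simp: coeff_eq_0)
  also have "\<dots> = poly (map_poly of_real p) z"
    by (simp add: poly_altdef degree_map_poly coeff_map_poly)
  finally show ?thesis .
qed

lemma map_poly_of_real_real: "map_poly of_real p = (p :: real poly)"
  by (rule poly_eqI) (simp add: coeff_map_poly)

lemma fps_abs_conv_X_power: "fps_abs_conv (fps_X ^ n) z"
  using fps_abs_conv_of_poly[of "monom 1 n"] by (simp add: fps_of_poly_monom)

lemma fps_value_X_power: "fps_value (fps_X ^ n) z = z ^ n"
  using fps_value_of_poly[of "monom 1 n"] by (simp add: fps_of_poly_monom map_poly_monom poly_monom)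

lemma fps_abs_conv_const: "fps_abs_conv (fps_const c) z"
  using fps_abs_conv_of_poly[of "[:c:]"] by (simp add: fps_of_poly_const)

lemma fps_value_const: "fps_value (fps_const c) z = of_real c"
  using fps_value_of_poly[of "[:c:]"] by (simp add: fps_of_poly_const map_poly_pCons)

lemma fps_eqI_value:
  fixes f g :: "real fps" and r :: real
  assumes conv: "fps_abs_conv f r" "fps_abs_conv g r" and "0 < r"
    and values_eq: "\<And>x. 0 < x \<Longrightarrow> x < r \<Longrightarrow> fps_value f x = fps_value g x"
  shows "f = g"
proof (rule ccontr)
  assume "f \<noteq> g"
  define h where "h = fps_X * (f - g)"
  have conv_inside: "fps_abs_conv f x" "fps_abs_conv g x" "fps_abs_conv fps_X x" if "norm x < r" for x :: real
    using conv that fps_abs_conv_X_power[of 1 x] by (auto intro: fps_abs_conv_mono)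
  have value_h: "fps_value h x = x * (fps_value f x - fps_value g x)" if "norm x < r" for x :: real
    using conv_inside[OF that] fps_value_X_power[of 1 x]
    by (simp add: h_def fps_value_mult fps_value_diff fps_abs_conv_diff)
  have sums_h: "(\<lambda>n. h $ n * (x - 0) ^ n) sums fps_value h x" if "norm (x - 0) < r" for x :: real
    using fps_value_real_sums[of h x] conv_inside[of x] that
    by (simp add: h_def fps_abs_conv_mult fps_abs_conv_diff)
  obtain m where "f $ m \<noteq> g $ m" using \<open>f \<noteq> g\<close> fps_ext by blast
  then have nonzero_coeff: "h $ Suc m \<noteq> 0" by (simp add: h_def)
  have "fps_value h (0 :: real) = 0" using value_h[of 0] \<open>0 < r\<close> by simp
  from powser_0_nonzero[OF \<open>0 < r\<close> sums_h this nonzero_coeff zero_less_Suc]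
  obtain s where "0 < s" and nonzero: "\<And>x. x \<in> cball 0 s - {0} \<Longrightarrow> fps_value h x \<noteq> (0::real)" by metis
  define x where "x = min s (r / 2)"
  have "0 < x" "x < r" "x \<le> s" using \<open>0 < s\<close> \<open>0 < r\<close> by (auto simp: x_def)
  then have "fps_value h x = 0" by (simp add: value_h values_eq)
  moreover have "x \<in> cball 0 s - {0}" using \<open>0 < x\<close> \<open>x \<le> s\<close> by simp
  ultimately show False using nonzero by blast
qed


section \<open>Powers of linear series\<close>

definition binom_fps :: "real \<Rightarrow> real \<Rightarrow> real fps" where
  "binom_fps c a = fps_binomial c oo (fps_const (- a) * fps_X)"

lemma binom_fps_nth: "binom_fps c a $ n = (c gchoose n) * (- a) ^ n"
  unfolding binom_fps_def fps_nth_compose_linear by (simp add: mult.commute)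

lemma binom_fps_add: "binom_fps (c + d) a = binom_fps c a * binom_fps d a"
  unfolding binom_fps_def fps_binomial_add_mult by (rule fps_compose_mult_distrib) simp

lemma binom_fps_0: "binom_fps 0 a = 1"
  by (simp add: binom_fps_def)

lemma binom_fps_1: "binom_fps 1 a = 1 - fps_const a * fps_X"
  unfolding binom_fps_def fps_binomial_1 fps_compose_add_distrib by simp

lemma fps_value_binom_fps_scale: "fps_value (binom_fps c a) z = fps_value (binom_fps c 1) (of_real a * z)"
  by (simp add: fps_value_def binom_fps_nth power_mult_distrib power_minus[of "of_real a * z"]
    power_minus[of a] mult_ac)

lemma fps_abs_conv_binom_fps:
  assumes "norm (of_real a * z) < 1"
  shows "fps_abs_conv (binom_fps c a) z"
proof (cases "c \<in> \<nat>")
  case True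
  then obtain k where "c = of_nat k" by (auto simp: Nats_def)
  then have "binom_fps c a = fps_of_poly ([:1, - a:] ^ k)"
    by (simp add: binom_fps_def fps_binomial_of_nat fps_compose_add_distrib fps_of_poly_power
      fps_of_poly_linear'
        del: fps_const_neg flip: fps_compose_power)
  then show ?thesis by (simp add: fps_abs_conv_of_poly)
next
  case False
  then have "summable (\<lambda>n. norm ((c gchoose n) * (norm (of_real a * z)) ^ n))"
    using assms by (intro abs_summable_in_conv_radius) (simp add: conv_radius_gchoose)
  then show ?thesis
    by (simp add: fps_abs_conv_def binom_fps_nth norm_mult norm_power power_mult_distrib abs_mult
      power_abs mult_ac)
qed

lemma fps_abs_conv_binom_fps_beyond_1:
  assumes "\<bar>a\<bar> < 1"
  obtains r :: real where "r > 1" "fps_abs_conv (binom_fps c a) r"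
proof -
  define r where "r = 2 / (1 + \<bar>a\<bar>)"
  have "r > 1" using assms by (simp add: r_def)
  have "norm (of_real a * r) < 1" using assms by (simp add: r_def abs_mult field_simps)
  then have "fps_abs_conv (binom_fps c a) r" by (rule fps_abs_conv_binom_fps)
  with \<open>r > 1\<close> show thesis by (rule that)
qed

lemma binom_fps_coeff_limit:
  "(\<lambda>n. binom_fps c 1 $ n * real (n + 1) powr (c + 1)) \<longlonglongrightarrow> inverse (Gamma (- c))"
proof -
  have "(\<lambda>n. (c gchoose n) / ((-1) ^ n / exp ((c + 1) * ln (real n))) * (real (n + 1) / real n) powr (c + 1))
      \<longlonglongrightarrow> inverse (Gamma (- c)) * 1 powr (c + 1)"
  proof (intro tendsto_mult tendsto_powr tendsto_const)
    show "(\<lambda>n. (c gchoose n) / ((-1) ^ n / exp ((c + 1) * ln (real n)))) \<longlonglongrightarrow> inverse (Gamma (- c))"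
      using gbinomial_asymptotic[of c] by simp
    show "(\<lambda>n. real (n + 1) / real n) \<longlonglongrightarrow> 1" by real_asymp
  qed simp
  moreover have "eventually (\<lambda>n. (c gchoose n) / ((-1) ^ n / exp ((c + 1) * ln (real n)))
      * (real (n + 1) / real n) powr (c + 1) = binom_fps c 1 $ n * real (n + 1) powr (c + 1)) sequentially"
    using eventually_gt_at_top[of 0]
  proof eventually_elim
    case (elim n)
    have "exp ((c + 1) * ln (real n)) * (real (n + 1) / real n) powr (c + 1) = real (n + 1) powr (c + 1)"
      using elim by (simp add: powr_def ln_div right_diff_distrib flip: exp_add)
    moreover have "inverse ((-1 :: real) ^ n) = (-1) ^ n" by (simp flip: power_inverse)
    ultimately show ?case by (simp add: binom_fps_nth divide_inverse mult_ac)
  qed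
  ultimately show ?thesis by (simp add: filterlim_cong)
qed

lemma powr_weight_convergent_bounded:
  assumes "(\<lambda>n. f $ n * real (n + 1) powr t) \<longlonglongrightarrow> L"
  obtains C where "\<And>n. \<bar>f $ n\<bar> \<le> C * real (n + 1) powr (- t)"
proof -
  obtain C where weighted: "\<And>n. \<bar>f $ n * real (n + 1) powr t\<bar> \<le> C"
    using convergent_imp_Bseq[OF convergentI[OF assms]] unfolding Bseq_def by auto
  have "\<bar>f $ n\<bar> \<le> C * real (n + 1) powr (- t)" for n
    using weighted[of n] by (simp add: abs_mult powr_minus_divide pos_le_divide_eq)
  then show thesis by (rule that)
qed

lemma fps_abs_conv_1_of_powr_weight:
  assumes "(\<lambda>n. f $ n * real (n + 1) powr t) \<longlonglongrightarrow> L" "t > 1"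
  shows "fps_abs_conv f (1 :: real)"
  unfolding fps_abs_conv_1_iff
proof -
  obtain C where coeff_le: "\<And>n. \<bar>f $ n\<bar> \<le> C * real (n + 1) powr (- t)"
    using powr_weight_convergent_bounded[OF assms(1)] by blast
  have "summable (\<lambda>n. real n powr (- t))" using assms(2) by (simp add: summable_real_powr_iff)
  then have "summable (\<lambda>n. C * real (n + 1) powr (- t))"
    by (intro summable_mult) (subst summable_iff_shift[of "\<lambda>n. real n powr (- t)" 1])
  then show "summable (\<lambda>n. \<bar>f $ n\<bar>)" by (rule summable_comparison_test') (use coeff_le in simp)
qed

lemma fps_abs_conv_binom_fps_boundary:
  assumes "c > 0" "norm (of_real a * z) \<le> 1"
  shows "fps_abs_conv (binom_fps c a) z"
  unfolding fps_abs_conv_def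
proof (rule summable_comparison_test')
  show "summable (\<lambda>n. \<bar>binom_fps c 1 $ n\<bar>)"
    using fps_abs_conv_1_of_powr_weight[OF binom_fps_coeff_limit[of c]] assms(1)
    by (simp add: fps_abs_conv_1_iff)
  show "norm (norm (of_real (binom_fps c a $ n) * z ^ n)) \<le> \<bar>binom_fps c 1 $ n\<bar>" for n
  proof -
    have "norm (of_real (binom_fps c a $ n) * z ^ n) = \<bar>binom_fps c 1 $ n\<bar> * norm (of_real a * z) ^ n"
      by (simp add: binom_fps_nth norm_mult norm_power power_mult_distrib abs_mult power_abs mult_ac)
    then show ?thesis using assms(2) by (simp add: mult_left_le power_le_one)
  qed
qed

lemma gbinomial_Suc_rec: "(c :: real) gchoose Suc n = (c gchoose n) * ((c - real n) / real (Suc n))"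
  using gbinomial_absorb_comp[of c n] gbinomial_absorption[of n c] by (simp add: field_simps)

lemma binom_fps_half_nth_nonpos: "binom_fps (1/2) 1 $ Suc n \<le> 0"
proof (induction n)
  case 0
  show ?case by (simp add: binom_fps_nth)
next
  case (Suc n)
  have "binom_fps (1/2) 1 $ Suc (Suc n)
      = binom_fps (1/2) 1 $ Suc n * ((real (Suc n) - 1/2) / real (Suc (Suc n)))"
    unfolding binom_fps_nth gbinomial_Suc_rec[of "1/2" "Suc n"]
    by (simp add: algebra_simps diff_divide_distrib)
  then show ?case using Suc by (simp only:) (intro mult_nonpos_nonneg, auto)
qed

lemma fps_value_binom_fps_half_square:
  fixes z :: "'a::{real_normed_field, banach}"
  assumes "norm z \<le> 1"
  shows "(fps_value (binom_fps (1/2) 1) z)\<^sup>2 = 1 - z"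
proof -
  have conv: "fps_abs_conv (binom_fps (1/2) 1) z" using assms by (intro fps_abs_conv_binom_fps_boundary) auto
  have "(fps_value (binom_fps (1/2) 1) z)\<^sup>2 = fps_value (binom_fps (1/2 + 1/2) 1) z"
    unfolding binom_fps_add power2_eq_square by (rule fps_value_mult[OF conv conv, symmetric])
  also have "\<dots> = fps_value (fps_of_poly [:1, -1:]) z"
    by (simp add: binom_fps_1 fps_of_poly_linear' flip: fps_const_neg)
  finally show ?thesis by (simp add: fps_value_of_poly map_poly_pCons)
qed

lemma binom_fps_half_tail_sums: "(\<lambda>n. \<bar>binom_fps (1/2) 1 $ Suc n\<bar>) sums 1"
proof -
  have "(\<lambda>n. binom_fps (1/2) 1 $ n * 1 ^ n) sums fps_value (binom_fps (1/2) 1) 1"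
    by (intro fps_value_real_sums fps_abs_conv_binom_fps_boundary) auto
  then have "(\<lambda>n. binom_fps (1/2) 1 $ n) sums 0"
    using fps_value_binom_fps_half_square[of "1::real"] by simp
  then have "(\<lambda>n. binom_fps (1/2) 1 $ Suc n) sums (- 1)"
    using sums_Suc_iff[of "\<lambda>n. binom_fps (1/2) 1 $ n" "- 1"] by (simp add: binom_fps_nth)
  then have "(\<lambda>n. - (binom_fps (1/2) 1 $ Suc n)) sums 1" using sums_minus by fastforce
  then show ?thesis using binom_fps_half_nth_nonpos by (simp add: abs_of_nonpos)
qed

lemma Re_fps_value_binom_fps_half_nonneg:
  assumes "norm z \<le> 1"
  shows "0 \<le> Re (fps_value (binom_fps (1/2) 1) z)"
proof -
  define a where "a n = complex_of_real (binom_fps (1/2) 1 $ n) * z ^ n" for n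
  have "a sums fps_value (binom_fps (1/2) 1) z"
    unfolding a_def using assms by (intro fps_value_sums fps_abs_conv_binom_fps_boundary) auto
  then have tail: "(\<lambda>n. a (Suc n)) sums (fps_value (binom_fps (1/2) 1) z - 1)"
    using sums_Suc_iff[of a "fps_value (binom_fps (1/2) 1) z - 1"] by (simp add: a_def binom_fps_nth)
  have "norm (a (Suc n)) \<le> \<bar>binom_fps (1/2) 1 $ Suc n\<bar>" for n
    using assms by (simp add: a_def norm_mult norm_power mult_left_le power_le_one del: power_Suc)
  then have "norm (\<Sum>n. a (Suc n)) \<le> (\<Sum>n. \<bar>binom_fps (1/2) 1 $ Suc n\<bar>)"
    using binom_fps_half_tail_sums by (intro norm_suminf_le) (auto simp: sums_iff)
  then have "norm (fps_value (binom_fps (1/2) 1) z - 1) \<le> 1"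
    using tail binom_fps_half_tail_sums by (simp add: sums_iff)
  then show ?thesis using abs_Re_le_cmod[of "fps_value (binom_fps (1/2) 1) z - 1"] by simp
qed

lemma fps_value_binom_fps_half:
  fixes z :: complex
  assumes "norm (of_real a * z) \<le> 1"
  shows "fps_value (binom_fps (1/2) a) z = csqrt (1 - of_real a * z)"
proof -
  define w where "w = of_real a * z"
  define s where "s = fps_value (binom_fps (1/2) 1) w"
  have square: "s\<^sup>2 = 1 - w" and Re_nonneg: "0 \<le> Re s"
    using assms fps_value_binom_fps_half_square[of w] Re_fps_value_binom_fps_half_nonneg[of w]
    by (simp_all add: s_def w_def)
  have "Im s = 0" if "Re s = 0"
  proof -
    have "Re (s\<^sup>2) = - (Im s)\<^sup>2" using that by (simp add: power2_eq_square)
    moreover have "0 \<le> Re (s\<^sup>2)" using complex_Re_le_cmod[of w] assms by (simp add: square w_def)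
    ultimately show ?thesis by simp
  qed
  then have "0 < Re s \<or> Re s = 0 \<and> 0 \<le> Im s" using Re_nonneg by force
  then have "csqrt (1 - w) = s" by (rule csqrt_unique[OF square])
  then show ?thesis by (simp add: s_def w_def fps_value_binom_fps_scale[of _ a])
qed

lemma powr_Suc_submult:
  assumes "k \<le> n" "t \<ge> 0"
  shows "real (n + 1) powr t \<le> real (k + 1) powr t * real (n - k + 1) powr t"
proof -
  obtain m where "n = k + m" using assms(1) le_Suc_ex by blast
  then have "real (n + 1) \<le> real (k + 1) * real (n - k + 1)" by (simp add: algebra_simps)
  then have "real (n + 1) powr t \<le> (real (k + 1) * real (n - k + 1)) powr t"
    using assms(2) by (intro powr_mono2) auto
  then show ?thesis by (simp add: powr_mult)
qed

lemma summable_powr_weight_of_abs_conv: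
  fixes r :: real
  assumes "fps_abs_conv f r" "r > 1"
  shows "summable (\<lambda>n. \<bar>f $ n\<bar> * real (n + 1) powr t)"
proof -
  have decay: "(\<lambda>n. real (n + 1) powr t / r ^ n) \<longlonglongrightarrow> 0" using assms(2) by real_asymp
  obtain C where quotient_le: "\<And>n. \<bar>real (n + 1) powr t / r ^ n\<bar> \<le> C"
    using convergent_imp_Bseq[OF convergentI[OF decay]] unfolding Bseq_def by auto
  have "summable (\<lambda>n. norm (f $ n * r ^ n) * C)"
    using assms(1) by (intro summable_mult2) (simp add: fps_abs_conv_def)
  then show ?thesis
  proof (rule summable_comparison_test'[where N = 0])
    fix n :: nat
    have "\<bar>f $ n\<bar> * real (n + 1) powr t = norm (f $ n * r ^ n) * \<bar>real (n + 1) powr t / r ^ n\<bar>"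
      using assms(2) by (simp add: abs_mult)
    also have "\<dots> \<le> norm (f $ n * r ^ n) * C" by (intro mult_left_mono quotient_le) simp
    finally show "norm (\<bar>f $ n\<bar> * real (n + 1) powr t) \<le> norm (f $ n * r ^ n) * C" by simp
  qed
qed

lemma fps_mult_weighted_limit_termwise:
  assumes "(\<lambda>n. f $ n * real (n + 1) powr t) \<longlonglongrightarrow> L"
  shows "(\<lambda>n. if k \<le> n then f $ (n - k) * real (n + 1) powr t else 0) \<longlonglongrightarrow> L"
proof (rule LIMSEQ_offset[where k = k])
  have "(\<lambda>n. (f $ n * real (n + 1) powr t) * (real (n + k + 1) / real (n + 1)) powr t) \<longlonglongrightarrow> L * 1 powr t"
  proof (intro tendsto_mult tendsto_powr tendsto_const assms)
    show "(\<lambda>n. real (n + k + 1) / real (n + 1)) \<longlonglongrightarrow> 1" by real_asymp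
  qed simp
  then show "(\<lambda>n. if k \<le> n + k then f $ (n + k - k) * real (n + k + 1) powr t else 0) \<longlonglongrightarrow> L"
    by (simp add: powr_divide)
qed

lemma powr_weight_shift_le:
  assumes coeff_le: "\<And>n. \<bar>f $ n\<bar> \<le> C * real (n + 1) powr (- t)" and "t \<ge> 0" "k \<le> n"
  shows "\<bar>f $ (n - k)\<bar> * real (n + 1) powr t \<le> real (k + 1) powr t * C"
proof -
  have "0 \<le> C" using coeff_le[of 0] by (simp add: order_trans[OF abs_ge_zero])
  then have "\<bar>f $ (n - k)\<bar> * real (n + 1) powr t
      \<le> (C * real (n - k + 1) powr (- t)) * (real (k + 1) powr t * real (n - k + 1) powr t)"
    using assms by (intro mult_mono coeff_le powr_Suc_submult) auto
  also have "\<dots> = real (k + 1) powr t * C" by (simp add: powr_minus field_simps)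
  finally show ?thesis .
qed

lemma fps_mult_weighted_limit:
  assumes f_limit: "(\<lambda>n. f $ n * real (n + 1) powr t) \<longlonglongrightarrow> L" and "t \<ge> 0"
    and g_conv: "fps_abs_conv g r" and "r > (1 :: real)"
  shows "(\<lambda>n. (f * g) $ n * real (n + 1) powr t) \<longlonglongrightarrow> L * fps_value g 1"
proof -
  define a where "a k n = g $ k * (if k \<le> n then f $ (n - k) * real (n + 1) powr t else 0)" for k n
  obtain C where coeff_le: "\<And>n. \<bar>f $ n\<bar> \<le> C * real (n + 1) powr (- t)"
    using powr_weight_convergent_bounded[OF f_limit] by blast
  then have "0 \<le> C" using order_trans[OF abs_ge_zero coeff_le[of 0]] by simp
  have dominated: "norm (a k n) \<le> \<bar>g $ k\<bar> * real (k + 1) powr t * C" for k n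
    using powr_weight_shift_le[OF coeff_le \<open>t \<ge> 0\<close>, of k n] \<open>0 \<le> C\<close>
    by (auto simp: a_def abs_mult mult.assoc intro!: mult_left_mono)
  have "(\<lambda>n. \<Sum>k. a k n) \<longlonglongrightarrow> (\<Sum>k. g $ k * L)"
  proof (rule tannerys_theorem[THEN conjunct2, THEN conjunct2])
    show "(\<lambda>n. a k n) \<longlonglongrightarrow> g $ k * L" for k
      unfolding a_def by (intro tendsto_mult_left fps_mult_weighted_limit_termwise f_limit)
    show "summable (\<lambda>k. \<bar>g $ k\<bar> * real (k + 1) powr t * C)"
      by (intro summable_mult2 summable_powr_weight_of_abs_conv[OF g_conv \<open>r > 1\<close>])
  qed (use dominated in \<open>auto intro!: always_eventually\<close>)
  also have "(\<lambda>n. \<Sum>k. a k n) = (\<lambda>n. (f * g) $ n * real (n + 1) powr t)"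
  proof
    fix n
    have "(\<Sum>k. a k n) = (\<Sum>k=0..n. a k n)" by (rule suminf_finite) (auto simp: a_def)
    also have "\<dots> = (g * f) $ n * real (n + 1) powr t"
      unfolding fps_mult_nth sum_distrib_right by (rule sum.cong) (auto simp: a_def)
    finally show "(\<Sum>k. a k n) = (f * g) $ n * real (n + 1) powr t" by (simp only: mult.commute)
  qed
  also have "(\<Sum>k. g $ k * L) = L * fps_value g 1"
    using sums_mult2[OF fps_value_real_sums[of g 1], of L] fps_abs_conv_mono[OF g_conv, of "1 :: real"]
      \<open>r > 1\<close>
    by (simp add: sums_iff mult.commute)
  finally show ?thesis .
qed


section \<open>The square root and its inverse\<close>

definition alpha :: real where
  "alpha = (sqrt 2 - 1)\<^sup>2"

lemma alpha_eq: "alpha = 3 - 2 * sqrt 2"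
  by (simp add: alpha_def power2_eq_square algebra_simps)

lemma alpha_square: "alpha\<^sup>2 = 6 * alpha - 1"
  by (simp add: alpha_eq power2_eq_square algebra_simps)

lemma alpha_pos: "0 < alpha"
  by (simp add: alpha_def)

lemma alpha_less_1: "alpha < 1"
proof -
  have "1 < sqrt 2" by simp
  then show ?thesis by (simp add: alpha_eq)
qed

lemma alpha_mult_less_1:
  assumes "x \<le> 1"
  shows "alpha * x < 1"
proof -
  have "alpha * x \<le> alpha * 1" using assms alpha_pos by (intro mult_left_mono) auto
  then show ?thesis using alpha_less_1 by simp
qed

lemma norm_alpha_mult_le_1:
  fixes z :: "'a::{real_normed_field, banach}"
  assumes "norm z \<le> 1"
  shows "norm (of_real alpha * z) \<le> 1"
  using alpha_mult_less_1[OF assms] alpha_pos by (simp add: norm_mult)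

definition sqrt_fps :: "real fps" where
  "sqrt_fps = binom_fps (1/2) 1 * binom_fps (1/2) alpha"

definition rsqrt_fps :: "real fps" where
  "rsqrt_fps = binom_fps (-1/2) 1 * binom_fps (-1/2) alpha"

lemma sqrt_fps_times_rsqrt_fps: "sqrt_fps * rsqrt_fps = 1"
proof -
  have cancel: "binom_fps (1/2) a * binom_fps (-1/2) a = 1" for a
    by (simp add: binom_fps_0 flip: binom_fps_add)
  have "sqrt_fps * rsqrt_fps
      = (binom_fps (1/2) 1 * binom_fps (-1/2) 1) * (binom_fps (1/2) alpha * binom_fps (-1/2) alpha)"
    by (simp only: sqrt_fps_def rsqrt_fps_def mult_ac)
  then show ?thesis by (simp only: cancel mult_1)
qed

lemma rsqrt_fps_nth_0: "rsqrt_fps $ 0 = 1"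
  by (simp add: rsqrt_fps_def binom_fps_nth)

lemma fps_abs_conv_sqrt_fps: "norm z \<le> 1 \<Longrightarrow> fps_abs_conv sqrt_fps z"
  unfolding sqrt_fps_def
  by (intro fps_abs_conv_mult fps_abs_conv_binom_fps_boundary norm_alpha_mult_le_1) simp_all

lemma fps_abs_conv_rsqrt_fps: "norm z < 1 \<Longrightarrow> fps_abs_conv rsqrt_fps z"
  unfolding rsqrt_fps_def using alpha_mult_less_1[of "norm z"] alpha_pos
  by (intro fps_abs_conv_mult fps_abs_conv_binom_fps) (simp_all add: norm_mult)

text \<open>Both factors \<open>1 - z\<close> and \<open>1 - \<alpha>z\<close> lie in the right half-plane, so the principal branches multiply.\<close>

lemma fps_value_sqrt_fps:
  fixes z :: complex
  assumes norm_le: "norm z \<le> 1"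
  shows "fps_value sqrt_fps z = csqrt ((1 - z) * (1 - z * of_real alpha))"
proof -
  have Re_pos: "0 \<le> Re (1 - z)" "0 < Re (1 - z * of_real alpha)"
    using norm_le complex_Re_le_cmod[of z] alpha_mult_less_1[of "Re z"] by (simp_all add: mult.commute)
  have "Arg (1 - z) + Arg (1 - z * of_real alpha) \<in> {-pi<..pi}"
    using Re_pos Arg_Re_nonneg[of "1 - z"] Arg_Re_pos[of "1 - z * of_real alpha"] by auto
  then have "csqrt ((1 - z) * (1 - z * of_real alpha)) = csqrt (1 - z) * csqrt (1 - z * of_real alpha)"
    by (rule csqrt_mult)
  also have "\<dots> = fps_value (binom_fps (1/2) 1) z * fps_value (binom_fps (1/2) alpha) z"
    using norm_le norm_alpha_mult_le_1[OF norm_le] by (simp add: fps_value_binom_fps_half mult.commute)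
  also have "\<dots> = fps_value sqrt_fps z"
    unfolding sqrt_fps_def using norm_le norm_alpha_mult_le_1[OF norm_le]
    by (intro fps_value_mult[symmetric] fps_abs_conv_binom_fps_boundary) simp_all
  finally show ?thesis by (rule sym)
qed

lemma fps_value_of_real:
  assumes "fps_abs_conv f x"
  shows "fps_value f (of_real x :: 'a::{real_normed_field, banach}) = of_real (fps_value f x)"
proof -
  have "(\<lambda>n. of_real (f $ n * x ^ n) :: 'a) sums of_real (fps_value f x)"
    unfolding sums_of_real_iff by (rule fps_value_real_sums[OF assms])
  then show ?thesis by (simp add: fps_value_def[of f "of_real x"] sums_iff)
qed

lemma fps_value_sqrt_fps_real:
  fixes x :: real
  assumes "0 \<le> x" "x \<le> 1"
  shows "fps_value sqrt_fps x = sqrt (1 - x) * sqrt (1 - alpha * x)"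
proof -
  have "complex_of_real (fps_value sqrt_fps x) = csqrt ((1 - of_real x) * (1 - of_real x * of_real alpha))"
    using assms fps_abs_conv_sqrt_fps[of x]
    by (simp add: fps_value_sqrt_fps flip: fps_value_of_real)
  also have "\<dots> = csqrt (of_real ((1 - x) * (1 - alpha * x)))" by (simp add: mult.commute)
  also have "\<dots> = of_real (sqrt ((1 - x) * (1 - alpha * x)))"
    using assms alpha_mult_less_1[of x] by (intro of_real_sqrt[symmetric]) simp
  finally show ?thesis by (simp only: of_real_eq_iff real_sqrt_mult)
qed

lemma fps_value_sqrt_fps_pos:
  fixes x :: real
  assumes "0 \<le> x" "x < 1"
  shows "0 < fps_value sqrt_fps x"
  using assms alpha_mult_less_1[of x] by (simp add: fps_value_sqrt_fps_real)

lemma fps_value_rsqrt_fps: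
  fixes x :: real
  assumes "norm x < 1"
  shows "fps_value sqrt_fps x * fps_value rsqrt_fps x = 1"
  using fps_value_mult[of sqrt_fps x rsqrt_fps] fps_value_const[of 1 x] assms
  by (simp add: fps_abs_conv_sqrt_fps fps_abs_conv_rsqrt_fps sqrt_fps_times_rsqrt_fps)

lemma Gamma_minus_half: "Gamma (- (1/2) :: real) = - 2 * sqrt pi"
proof -
  have "- (1/2 :: real) \<notin> \<int>" using fraction_not_in_Ints[of 2 "-1", where 'a = real] by simp
  then have "- (1/2 :: real) \<notin> \<int>\<^sub>\<le>\<^sub>0" using nonpos_Ints_Int by blast
  then show ?thesis using Gamma_plus1[of "- (1/2) :: real"] Gamma_one_half_real by simp
qed

lemma sqrt_fps_coeff_limit:
  "(\<lambda>n. sqrt_fps $ n * real (n + 1) powr (3/2)) \<longlonglongrightarrow> - sqrt ((sqrt 2 - 1) / (2 * pi))"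
proof -
  have "\<bar>alpha\<bar> < 1" using alpha_pos alpha_less_1 by simp
  then obtain r :: real where "r > 1" and conv: "fps_abs_conv (binom_fps (1/2) alpha) r"
    by (rule fps_abs_conv_binom_fps_beyond_1)
  have "(\<lambda>n. sqrt_fps $ n * real (n + 1) powr (1/2 + 1))
      \<longlonglongrightarrow> inverse (Gamma (- (1/2))) * fps_value (binom_fps (1/2) alpha) 1"
    unfolding sqrt_fps_def by (rule fps_mult_weighted_limit[OF binom_fps_coeff_limit _ conv \<open>r > 1\<close>]) simp
  moreover have "fps_value (binom_fps (1/2) alpha) 1 = sqrt (1 - alpha)"
    using fps_value_binom_fps_half[of alpha 1] alpha_pos alpha_less_1 \<open>r > 1\<close>
      fps_abs_conv_mono[OF conv, of "1 :: real"]
      fps_value_of_real[of "binom_fps (1/2) alpha" 1, where 'a = complex] csqrt_of_real[of "1 - alpha"]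
    by simp
  moreover have "sqrt ((sqrt 2 - 1) / (2 * pi)) = sqrt (1 - alpha) / (2 * sqrt pi)"
  proof -
    have "(sqrt 2 - 1) / (2 * pi) = (1 - alpha) / (4 * pi)" by (simp add: alpha_eq field_simps)
    then show ?thesis by (simp add: real_sqrt_divide real_sqrt_mult)
  qed
  moreover have "inverse (Gamma (- (1/2))) * sqrt (1 - alpha) = - (sqrt (1 - alpha) / (2 * sqrt pi))"
    by (simp add: Gamma_minus_half field_simps)
  ultimately show ?thesis by simp
qed

lemma rsqrt_fps_tendsto_0: "(\<lambda>n. rsqrt_fps $ n) \<longlonglongrightarrow> 0"
proof -
  have "\<bar>alpha\<bar> < 1" using alpha_pos alpha_less_1 by simp
  then obtain r :: real where "r > 1" and conv: "fps_abs_conv (binom_fps (-1/2) alpha) r"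
    by (rule fps_abs_conv_binom_fps_beyond_1)
  obtain L where "(\<lambda>n. rsqrt_fps $ n * real (n + 1) powr (-1/2 + 1)) \<longlonglongrightarrow> L"
    unfolding rsqrt_fps_def
    using fps_mult_weighted_limit[OF binom_fps_coeff_limit _ conv \<open>r > 1\<close>, of "-1/2"] by simp
  moreover have "(\<lambda>n. real (n + 1) powr (-1/2)) \<longlonglongrightarrow> 0" by real_asymp
  ultimately have "(\<lambda>n. (rsqrt_fps $ n * real (n + 1) powr (-1/2 + 1)) * real (n + 1) powr (-1/2)) \<longlonglongrightarrow> L * 0"
    by (rule tendsto_mult)
  then show ?thesis by (simp add: mult.assoc flip: powr_add)
qed


section \<open>Convolution and Fourier series\<close>

lemma summable_on_scaleR_bounded:
  fixes f :: "'a \<Rightarrow> real" and g :: "'a \<Rightarrow> 'b::banach"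
  assumes "f summable_on A" "bounded (g ` A)"
  shows "(\<lambda>x. f x *\<^sub>R g x) summable_on A"
proof -
  obtain M where norm_g: "\<And>x. x \<in> A \<Longrightarrow> norm (g x) \<le> M" using assms(2) by (auto simp: bounded_iff)
  have "(\<lambda>x. norm (M *\<^sub>R f x)) summable_on A"
    using assms(1) by (intro summable_on_iff_abs_summable_on_real[THEN iffD1] summable_on_scaleR_right)
  then have "(\<lambda>x. norm (f x *\<^sub>R g x)) summable_on A"
  proof (rule Infinite_Sum.abs_summable_on_comparison_test)
    show "norm (f x *\<^sub>R g x) \<le> norm (M *\<^sub>R f x)" if "x \<in> A" for x
      using mult_right_mono[OF order_trans[OF norm_g[OF that] abs_ge_self], of "\<bar>f x\<bar>"]
      by (simp add: abs_mult mult.commute)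
  qed
  then show ?thesis by (rule abs_summable_summable)
qed

lemma summable_on_product_real:
  fixes f :: "'a \<Rightarrow> real" and g :: "'b \<Rightarrow> real"
  assumes "f summable_on A" "g summable_on B"
  shows "(\<lambda>(x, y). f x * g y) summable_on A \<times> B"
proof -
  have abs_summable: "(\<lambda>x. \<bar>f x\<bar>) summable_on A" "(\<lambda>y. \<bar>g y\<bar>) summable_on B"
    using assms summable_on_iff_abs_summable_on_real[of f A] summable_on_iff_abs_summable_on_real[of g B]
    by simp_all
  have "(\<lambda>(x, y). \<bar>f x\<bar> * \<bar>g y\<bar>) summable_on A \<times> B"
  proof (rule summable_on_SigmaI)
    show "((\<lambda>y. case (x, y) of (x, y) \<Rightarrow> \<bar>f x\<bar> * \<bar>g y\<bar>) has_sum \<bar>f x\<bar> * (\<Sum>\<^sub>\<infinity>y\<in>B. \<bar>g y\<bar>)) B" for x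
      using abs_summable(2) by (simp add: has_sum_cmult_right)
    show "(\<lambda>x. \<bar>f x\<bar> * (\<Sum>\<^sub>\<infinity>y\<in>B. \<bar>g y\<bar>)) summable_on A"
      using abs_summable(1) by (rule summable_on_cmult_left)
  qed simp
  then have "(\<lambda>p. norm (case p of (x, y) \<Rightarrow> f x * g y)) summable_on A \<times> B"
    by (simp add: case_prod_unfold abs_mult)
  then show ?thesis by (rule abs_summable_summable)
qed

definition convolution :: "('a::ab_group_add \<Rightarrow> real) \<Rightarrow> ('a \<Rightarrow> 'b::banach) \<Rightarrow> 'a \<Rightarrow> 'b" where
  "convolution f v n = (\<Sum>\<^sub>\<infinity>k. f k *\<^sub>R v (n - k))"

lemma summable_on_convolution_terms:
  fixes v :: "'a::ab_group_add \<Rightarrow> 'b::banach"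
  assumes "f summable_on UNIV" "bounded (range v)"
  shows "(\<lambda>k. f k *\<^sub>R v (n - k)) summable_on UNIV"
proof (rule summable_on_scaleR_bounded[OF assms(1)])
  show "bounded (range (\<lambda>k. v (n - k)))" by (rule bounded_subset[OF assms(2)]) auto
qed

lemma has_sum_convolution:
  assumes "f summable_on UNIV" "bounded (range v)"
  shows "((\<lambda>k. f k *\<^sub>R v (n - k)) has_sum convolution f v n) UNIV"
  unfolding convolution_def by (rule has_sum_infsum[OF summable_on_convolution_terms[OF assms]])

lemma norm_convolution_le:
  assumes "f summable_on UNIV" and norm_v: "\<And>k. f k \<noteq> 0 \<Longrightarrow> norm (v (n - k)) \<le> C"
  shows "norm (convolution f v n) \<le> (\<Sum>\<^sub>\<infinity>k. \<bar>f k\<bar>) * C"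
proof -
  have dominating_sum: "((\<lambda>k. \<bar>f k\<bar> * C) has_sum (\<Sum>\<^sub>\<infinity>k. \<bar>f k\<bar>) * C) UNIV"
    using assms(1) summable_on_iff_abs_summable_on_real[of f UNIV]
    by (intro has_sum_cmult_left has_sum_infsum) simp
  have dominated: "norm (f k *\<^sub>R v (n - k)) \<le> \<bar>f k\<bar> * C" for k
    using norm_v[of k] by (cases "f k = 0") (auto intro: mult_left_mono)
  have "(\<lambda>k. norm (f k *\<^sub>R v (n - k))) summable_on UNIV"
    by (rule Infinite_Sum.abs_summable_on_comparison_test'
        [OF has_sum_imp_summable[OF dominating_sum] dominated])
  then have "(\<lambda>k. f k *\<^sub>R v (n - k)) summable_on UNIV" by (rule abs_summable_summable)
  from norm_infsum_le[OF has_sum_infsum[OF this] dominating_sum dominated]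
  show ?thesis by (simp add: convolution_def)
qed

lemma bounded_convolution:
  assumes "f summable_on UNIV" "bounded (range v)"
  shows "bounded (range (convolution f v))"
proof -
  obtain M where "\<And>n. norm (v n) \<le> M" using assms(2) by (auto simp: bounded_iff)
  then show ?thesis
    by (intro boundedI[where B = "(\<Sum>\<^sub>\<infinity>k. \<bar>f k\<bar>) * M"]) (auto intro: norm_convolution_le[OF assms(1)])
qed

lemma convolution_add_right:
  assumes "f summable_on UNIV" "bounded (range v)" "bounded (range w)"
  shows "convolution f (\<lambda>k. v k + w k) n = convolution f v n + convolution f w n"
  using infsum_add[OF summable_on_convolution_terms[OF assms(1,2)]
    summable_on_convolution_terms[OF assms(1,3)]]
  by (simp add: convolution_def scaleR_add_right)

lemma convolution_scaleR_right: "convolution f (\<lambda>k. c *\<^sub>R v k) n = c *\<^sub>R convolution f v n"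
  unfolding convolution_def infsum_scaleR_right[symmetric] by (simp add: mult.commute)

lemma convolution_diff_right:
  assumes "f summable_on UNIV" "bounded (range v)" "bounded (range w)"
  shows "convolution f (\<lambda>k. v k - w k) n = convolution f v n - convolution f w n"
proof -
  have "bounded (range (\<lambda>k. (-1) *\<^sub>R w k))" using assms(3) by (simp add: bounded_iff)
  from convolution_add_right[OF assms(1,2) this, of n] show ?thesis
    unfolding convolution_scaleR_right by simp
qed

lemma convolution_cmult_right:
  fixes v :: "'a::ab_group_add \<Rightarrow> 'b::{real_normed_field, banach}"
  shows "convolution f (\<lambda>k. c * v k) n = c * convolution f v n"
  unfolding convolution_def infsum_cmult_right'[symmetric] by (simp add: mult.commute)

lemma convolution_add_left:
  assumes "f summable_on UNIV" "g summable_on UNIV" "bounded (range v)"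
  shows "convolution (\<lambda>k. f k + g k) v n = convolution f v n + convolution g v n"
  using infsum_add[OF summable_on_convolution_terms[OF assms(1,3)]
    summable_on_convolution_terms[OF assms(2,3)]]
  by (simp add: convolution_def scaleR_add_left)

lemma convolution_cmult_left: "convolution (\<lambda>k. c * f k) v n = c *\<^sub>R convolution f v n"
  by (simp add: convolution_def flip: infsum_scaleR_right)

lemma convolution_shift: "convolution (\<lambda>k. f (k + d)) v n = convolution f v (n + d)"
  unfolding convolution_def
  by (rule infsum_reindex_bij_witness[of _ "\<lambda>k. k - d" "\<lambda>k. k + d"]) (auto simp: algebra_simps)

lemma convolution_reflect: "convolution (\<lambda>k. f (- k)) (\<lambda>k. v (- k)) n = convolution f v (- n)"
  unfolding convolution_def
  by (rule infsum_reindex_bij_witness[of _ uminus uminus]) (auto simp: algebra_simps)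

lemma convolution_commute: "convolution f g n = convolution g f (n :: 'a::ab_group_add)"
  unfolding convolution_def
  by (rule infsum_reindex_bij_witness[of _ "\<lambda>k. n - k" "\<lambda>k. n - k"]) auto

lemma has_sum_delta:
  fixes v :: "'a \<Rightarrow> 'b::banach"
  shows "((\<lambda>k. (if k = a then c else 0) *\<^sub>R v k) has_sum c *\<^sub>R v a) UNIV"
  by (rule has_sum_finite_neutralI[of "{a}"]) auto

lemma summable_on_delta: "(\<lambda>k. if k = a then c else 0 :: real) summable_on UNIV"
  using has_sum_imp_summable[OF has_sum_delta[of a c "\<lambda>_. 1 :: real"]] by simp

lemma convolution_delta: "convolution (\<lambda>k. if k = a then c else 0) v n = c *\<^sub>R v (n - a)"
  unfolding convolution_def by (rule infsumI[OF has_sum_delta])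

lemma summable_on_convolution_product:
  fixes f g :: "'a::ab_group_add \<Rightarrow> real"
  assumes "f summable_on UNIV" "g summable_on UNIV"
  shows "(\<lambda>(k, i). f i * g (k - i)) summable_on UNIV \<times> UNIV"
proof -
  have "(\<lambda>(k, i). f i * g (k - i)) summable_on UNIV \<times> UNIV \<longleftrightarrow> (\<lambda>(i, j). f i * g j) summable_on UNIV \<times> UNIV"
    by (rule summable_on_reindex_bij_witness[of _ "\<lambda>(i, j). (i + j, i)" "\<lambda>(k, i). (i, k - i)"]) auto
  then show ?thesis using summable_on_product_real[OF assms] by simp
qed

lemma summable_on_convolution:
  fixes f g :: "'a::ab_group_add \<Rightarrow> real"
  assumes "f summable_on UNIV" "g summable_on UNIV"
  shows "convolution f g summable_on UNIV"
  using summable_on_Sigma_banach[OF summable_on_convolution_product[OF assms]]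
  by (simp add: convolution_def[abs_def])

lemma convolution_assoc:
  fixes f g :: "'a::ab_group_add \<Rightarrow> real" and v :: "'a \<Rightarrow> 'b::banach"
  assumes "f summable_on UNIV" "g summable_on UNIV" "bounded (range v)"
  shows "convolution f (convolution g v) n = convolution (convolution f g) v n"
proof -
  note product = summable_on_convolution_product[OF assms(1,2)]
  have "(\<lambda>p. (case p of (k, i) \<Rightarrow> f i * g (k - i)) *\<^sub>R v (n - fst p)) summable_on UNIV \<times> UNIV"
    by (intro summable_on_scaleR_bounded product bounded_subset[OF assms(3)]) auto
  then have summable_both: "(\<lambda>(k, i). (f i * g (k - i)) *\<^sub>R v (n - k)) summable_on UNIV \<times> UNIV"
    by (simp add: case_prod_unfold)
  have "(\<lambda>i. f i * g (k - i)) summable_on UNIV" for k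
    using summable_on_SigmaD1[OF product, of k] by simp
  then have "convolution (convolution f g) v n = (\<Sum>\<^sub>\<infinity>k. \<Sum>\<^sub>\<infinity>i. (f i * g (k - i)) *\<^sub>R v (n - k))"
    by (simp add: convolution_def infsum_scaleR_left)
  also have "\<dots> = (\<Sum>\<^sub>\<infinity>i. \<Sum>\<^sub>\<infinity>k. (f i * g (k - i)) *\<^sub>R v (n - k))" by (rule infsum_swap_banach[OF summable_both])
  also have "\<dots> = (\<Sum>\<^sub>\<infinity>i. f i *\<^sub>R convolution g v (n - i))"
  proof -
    have "convolution g v (n - i) = (\<Sum>\<^sub>\<infinity>k. g (k - i) *\<^sub>R v (n - k))" for i
      using convolution_shift[of g "- i" v n] by (simp add: convolution_def)
    then show ?thesis by (simp flip: infsum_scaleR_right)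
  qed
  finally show ?thesis by (simp add: convolution_def[of f])
qed

abbreviation int_coeff :: "real fps \<Rightarrow> int \<Rightarrow> real" where
  "int_coeff f \<equiv> fls_nth (fps_to_fls f)"

lemma has_sum_int_coeff_iff:
  fixes v :: "int \<Rightarrow> 'b::banach"
  shows "((\<lambda>k. int_coeff f k *\<^sub>R v k) has_sum s) UNIV \<longleftrightarrow> ((\<lambda>n. (f $ n) *\<^sub>R v (int n)) has_sum s) UNIV"
proof -
  have "((\<lambda>k. int_coeff f k *\<^sub>R v k) has_sum s) UNIV \<longleftrightarrow> ((\<lambda>k. int_coeff f k *\<^sub>R v k) has_sum s) {0..}"
    by (rule has_sum_cong_neutral) auto
  also have "\<dots> \<longleftrightarrow> ((\<lambda>n. (f $ n) *\<^sub>R v (int n)) has_sum s) UNIV"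
    by (rule has_sum_reindex_bij_witness[of _ int nat]) auto
  finally show ?thesis .
qed

lemma summable_on_int_coeff:
  assumes "fps_abs_conv f (1 :: real)"
  shows "int_coeff f summable_on UNIV"
proof -
  have "(\<lambda>n. f $ n) summable_on UNIV"
    using assms by (intro norm_summable_imp_summable_on) (simp add: fps_abs_conv_def)
  then show ?thesis using has_sum_int_coeff_iff[of f "\<lambda>_. 1 :: real"]
    by (simp add: summable_on_def del: fps_to_fls_nth)
qed

lemma bounded_int_coeff:
  assumes "Bseq (fps_nth f)"
  shows "bounded (range (int_coeff f))"
proof -
  obtain C where "0 < C" "\<And>n. \<bar>f $ n\<bar> \<le> C" using assms by (auto simp: Bseq_def)
  then show ?thesis by (intro boundedI[of _ C]) auto
qed

lemma convolution_int_coeff: "convolution (int_coeff f) (int_coeff g) = int_coeff (f * g)"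
proof
  fix n
  have "((\<lambda>i. (f $ i) *\<^sub>R int_coeff g (n - int i)) has_sum int_coeff (f * g) n) UNIV"
  proof (rule has_sum_finite_neutralI)
    show "int_coeff (f * g) n = (\<Sum>i\<in>{i. int i \<le> n}. (f $ i) *\<^sub>R int_coeff g (n - int i))"
    proof (cases "n < 0")
      case True
      then have "{i. int i \<le> n} = {}" by auto
      then show ?thesis using True by simp
    next
      case False
      have "{i. int i \<le> n} = {0..nat n}" using False by auto
      moreover have "(\<Sum>i=0..nat n. f $ i * g $ (nat n - i)) = (\<Sum>i=0..nat n. (f $ i) *\<^sub>R int_coeff g (n - int i))"
        using False by (intro sum.cong) (auto simp: nat_diff_distrib')
      ultimately show ?thesis using False by (simp add: fps_mult_nth)
    qed
    show "finite {i. int i \<le> n}" by (rule finite_subset[of _ "{..nat n}"]) auto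
  qed auto
  then show "convolution (int_coeff f) (int_coeff g) n = int_coeff (f * g) n"
    unfolding convolution_def by (intro infsumI) (simp only: has_sum_int_coeff_iff)
qed

definition fourier :: "(int \<Rightarrow> real) \<Rightarrow> real \<Rightarrow> complex" where
  "fourier f t = (\<Sum>\<^sub>\<infinity>k. f k *\<^sub>R cis (- (of_int k * t)))"

lemma bounded_range_cis: "bounded (range (\<lambda>k. cis (a k)))"
  by (rule boundedI[of _ 1]) auto

lemma has_sum_fourier:
  assumes "f summable_on UNIV"
  shows "((\<lambda>k. f k *\<^sub>R cis (- (of_int k * t))) has_sum fourier f t) UNIV"
  unfolding fourier_def by (intro has_sum_infsum summable_on_scaleR_bounded assms bounded_range_cis)

lemma convolution_cis: "convolution f (\<lambda>k. cis (of_int k * t)) n = fourier f t * cis (of_int n * t)"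
proof -
  have "f k *\<^sub>R cis (of_int (n - k) * t) = f k *\<^sub>R cis (- (of_int k * t)) * cis (of_int n * t)" for k
    by (simp add: cis_mult left_diff_distrib)
  then show ?thesis unfolding convolution_def fourier_def by (simp only: infsum_cmult_left')
qed

lemma fourier_convolution:
  assumes "f summable_on UNIV" "g summable_on UNIV"
  shows "fourier (convolution f g) t = fourier f t * fourier g t"
proof -
  have "fourier (convolution f g) t = convolution (convolution f g) (\<lambda>k. cis (of_int k * t)) 0"
    by (simp add: convolution_cis)
  also have "\<dots> = convolution f (convolution g (\<lambda>k. cis (of_int k * t))) 0"
    by (rule convolution_assoc[symmetric, OF assms bounded_range_cis])
  also have "\<dots> = fourier g t * fourier f t"
    unfolding convolution_cis[abs_def] by (simp add: convolution_cmult_right convolution_cis)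
  finally show ?thesis by simp
qed

lemma fourier_add:
  assumes "f summable_on UNIV" "g summable_on UNIV"
  shows "fourier (\<lambda>k. f k + g k) t = fourier f t + fourier g t"
  using has_sum_add[OF assms[THEN has_sum_fourier, of t]] by (simp add: fourier_def infsumI scaleR_add_left)

lemma fourier_cmult: "fourier (\<lambda>k. c * f k) t = of_real c * fourier f t"
  by (simp add: fourier_def scaleR_conv_of_real mult.assoc infsum_cmult_right')

lemma fourier_delta: "fourier (\<lambda>k. if k = 0 then 1 else 0) t = 1"
  unfolding fourier_def by (subst infsumI[OF has_sum_delta]) simp

lemma fourier_reflect: "fourier (\<lambda>k. f (- k)) t = cnj (fourier f t)"
proof -
  have "fourier (\<lambda>k. f (- k)) t = (\<Sum>\<^sub>\<infinity>k. f k *\<^sub>R cis (of_int k * t))"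
    unfolding fourier_def by (rule infsum_reindex_bij_witness[of _ uminus uminus]) auto
  also have "\<dots> = (\<Sum>\<^sub>\<infinity>k. cnj (f k *\<^sub>R cis (- (of_int k * t))))" by (simp add: cis_cnj)
  finally show ?thesis by (simp only: infsum_cnj fourier_def)
qed

lemma fourier_int_coeff:
  assumes "fps_abs_conv f (1 :: real)"
  shows "fourier (int_coeff f) t = fps_value f (cis (- t))"
proof -
  have "((\<lambda>n. (f $ n) *\<^sub>R cis (- (of_int (int n) * t))) has_sum fourier (int_coeff f) t) UNIV"
    using has_sum_fourier[OF summable_on_int_coeff[OF assms], of t] by (simp only: has_sum_int_coeff_iff)
  then have "(\<lambda>n. (f $ n) *\<^sub>R cis (- (of_int (int n) * t))) sums fourier (int_coeff f) t"
    by (rule has_sum_imp_sums)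
  moreover have "(f $ n) *\<^sub>R cis (- (of_int (int n) * t)) = of_real (f $ n) * cis (- t) ^ n" for n
    by (simp add: Complex.DeMoivre scaleR_conv_of_real)
  ultimately show ?thesis by (simp add: fps_value_def sums_iff)
qed

lemma has_integral_cis_int:
  "((\<lambda>t. cis (of_int m * t)) has_integral (if m = 0 then complex_of_real (2 * pi) else 0)) {-pi..pi}"
proof (cases "m = 0")
  case True
  then show ?thesis using has_integral_const_real[of "1::complex" "-pi" pi] by (simp add: scaleR_conv_of_real)
next
  case False
  define F where "F t = cis (of_int m * t) / (\<i> * of_int m)" for t
  have "((\<lambda>t. cis (of_int m * t)) has_integral (F pi - F (- pi))) {-pi..pi}"
  proof (rule fundamental_theorem_of_calculus)
    fix t :: real
    show "(F has_vector_derivative cis (of_int m * t)) (at t within {-pi..pi})"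
      unfolding F_def has_vector_derivative_def using False
      by (auto intro!: derivative_eq_intros simp: fun_eq_iff scaleR_conv_of_real mult_ac)
  qed simp
  moreover have "cis (of_int m * pi) = cis (- (of_int m * pi))"
    by (simp add: complex_eq_iff sin_npi_int mult.commute)
  ultimately show ?thesis using False by (simp add: F_def)
qed

lemma fourier_eq_0_imp_eq_0:
  assumes summable: "f summable_on UNIV" and zero: "\<And>t. fourier f t = 0"
  shows "f n = 0"
proof -
  define h where "h k t = f k *\<^sub>R cis (of_int (n - k) * t)" for k t
  have h_eq: "h k t = f k *\<^sub>R cis (- (of_int k * t)) * cis (of_int n * t)" for k t
    by (simp add: h_def cis_mult left_diff_distrib)
  have "uniform_limit {-pi..pi} (\<lambda>X t. \<Sum>k\<in>X. h k t) (\<lambda>t. \<Sum>\<^sub>\<infinity>k. h k t) (finite_subsets_at_top UNIV)"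
    using summable summable_on_iff_abs_summable_on_real[of f UNIV]
    by (intro Weierstrass_m_test_general[where M = "\<lambda>k. \<bar>f k\<bar>"]) (simp_all add: h_def)
  moreover have "(\<Sum>\<^sub>\<infinity>k. h k t) = 0" for t
    using zero[of t] unfolding h_eq infsum_cmult_left' fourier_def by simp
  ultimately have "uniform_limit {-pi..pi} (\<lambda>X t. \<Sum>k\<in>X. h k t) (\<lambda>t. 0) (finite_subsets_at_top UNIV)" by simp
  then obtain I J where has_integral_I: "\<And>X. ((\<lambda>t. \<Sum>k\<in>X. h k t) has_integral I X) {-pi..pi}"
    and has_integral_J: "((\<lambda>t::real. 0::complex) has_integral J) {-pi..pi}"
      and I_tendsto: "(I \<longlongrightarrow> J) (finite_subsets_at_top UNIV)"
    by (rule uniform_limit_integral) (auto simp: h_def intro!: continuous_intros)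
  have "I X = of_real (2 * pi * f n)" if "finite X" "n \<in> X" for X
  proof -
    have "((\<lambda>t. \<Sum>k\<in>X. h k t) has_integral
      (\<Sum>k\<in>X. f k *\<^sub>R (if n - k = 0 then complex_of_real (2 * pi) else 0))) {-pi..pi}"
      unfolding h_def by (intro has_integral_sum has_integral_cmul that has_integral_cis_int)
    then have "I X = (\<Sum>k\<in>X. f k *\<^sub>R (if n - k = 0 then complex_of_real (2 * pi) else 0))"
      using has_integral_I has_integral_unique by blast
    also have "\<dots> = (\<Sum>k\<in>X. if k = n then of_real (2 * pi * f n) else 0)"
      by (rule sum.cong) (auto simp: scaleR_conv_of_real)
    finally show ?thesis using that by simp
  qed
  then have "eventually (\<lambda>X. I X = of_real (2 * pi * f n)) (finite_subsets_at_top UNIV)"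
    unfolding eventually_finite_subsets_at_top by (intro exI[of _ "{n}"]) auto
  then have "(I \<longlongrightarrow> of_real (2 * pi * f n)) (finite_subsets_at_top UNIV)" by (rule tendsto_eventually)
  then have "complex_of_real (2 * pi * f n) = J" using I_tendsto by (intro tendsto_unique) auto
  then show ?thesis using has_integral_J by simp
qed

lemma fourier_inject:
  assumes "f summable_on UNIV" "g summable_on UNIV" and fourier_eq: "\<And>t. fourier f t = fourier g t"
  shows "f n = g n"
proof -
  have summable_neg: "(\<lambda>k. -1 * g k) summable_on UNIV" by (rule summable_on_cmult_right[OF assms(2)])
  have "f n + -1 * g n = 0"
  proof (rule fourier_eq_0_imp_eq_0[OF summable_on_add[OF assms(1) summable_neg]])
    show "fourier (\<lambda>k. f k + -1 * g k) t = 0" for t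
      unfolding fourier_add[OF assms(1) summable_neg] fourier_cmult fourier_eq by simp
  qed
  then show ?thesis by simp
qed


section \<open>Harmonic functions and hitting probabilities on the square lattice\<close>

fun neighbour_mean :: "(int \<times> int \<Rightarrow> 'b::real_vector) \<Rightarrow> int \<times> int \<Rightarrow> 'b" where
  "neighbour_mean F (i, j) = (1/4) *\<^sub>R (F (i + 1, j) + F (i - 1, j) + F (i, j + 1) + F (i, j - 1))"

lemma neighbour_mean_const: "neighbour_mean (\<lambda>_. c) s = c"
proof (cases s)
  case (Pair i j)
  have "c + c + c + c = (1 + 1 + 1 + 1) *\<^sub>R c" by (simp only: scaleR_add_left scaleR_one)
  then show ?thesis by (simp add: Pair)
qed

lemma neighbour_mean_diff: "neighbour_mean (\<lambda>s. F s - G s) s = neighbour_mean F s - neighbour_mean G s"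
  by (cases s) (simp add: algebra_simps)

lemma tendsto_neighbour_mean:
  fixes F :: "'a \<Rightarrow> int \<times> int \<Rightarrow> 'b::real_normed_vector"
  assumes "\<And>s. ((\<lambda>x. F x s) \<longlongrightarrow> L s) net"
  shows "((\<lambda>x. neighbour_mean (F x) s) \<longlongrightarrow> neighbour_mean L s) net"
  by (cases s) (auto intro!: tendsto_intros assms)

lemma sums_neighbour_mean:
  fixes F :: "nat \<Rightarrow> int \<times> int \<Rightarrow> 'b::real_normed_vector"
  assumes "\<And>s. (\<lambda>n. F n s) sums L s"
  shows "(\<lambda>n. neighbour_mean (F n) s) sums neighbour_mean L s"
  by (cases s) (auto intro!: sums_scaleR_right sums_add assms)

lemma norm_neighbour_mean_le: "norm (neighbour_mean F s) \<le> neighbour_mean (\<lambda>s. norm (F s)) s"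
proof (cases s)
  case (Pair i j)
  have "norm (a + b + c + d) \<le> norm a + norm b + norm c + norm d" for a b c d :: 'a
    by (intro order_trans[OF norm_triangle_ineq] add_mono) auto
  then show ?thesis by (simp add: Pair)
qed

lemma neighbour_mean_sum: "neighbour_mean (\<lambda>s. \<Sum>x\<in>X. F x s) s = (\<Sum>x\<in>X. neighbour_mean (F x) s)"
  by (cases s) (simp add: sum.distrib flip: scaleR_sum_right)

lemma neighbour_mean_nonneg: "(\<And>s. 0 \<le> (F s :: real)) \<Longrightarrow> 0 \<le> neighbour_mean F s"
  by (cases s) simp

lemma neighbour_mean_le:
  fixes c :: real
  assumes "\<And>s. F s \<le> c"
  shows "neighbour_mean F s \<le> c"
proof (cases s)
  case (Pair i j)
  then show ?thesis
    using assms[of "(i + 1, j)"] assms[of "(i - 1, j)"] assms[of "(i, j + 1)"] assms[of "(i, j - 1)"] by simp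
qed

definition lattice_harmonic_on :: "(int \<times> int) set \<Rightarrow> (int \<times> int \<Rightarrow> 'b::real_vector) \<Rightarrow> bool" where
  "lattice_harmonic_on A F \<longleftrightarrow> (\<forall>s\<in>A. F s = neighbour_mean F s)"

lemma lattice_harmonic_onI: "(\<And>s. s \<in> A \<Longrightarrow> F s = neighbour_mean F s) \<Longrightarrow> lattice_harmonic_on A F"
  by (simp add: lattice_harmonic_on_def)

lemma lattice_harmonic_onD: "lattice_harmonic_on A F \<Longrightarrow> s \<in> A \<Longrightarrow> F s = neighbour_mean F s"
  by (simp add: lattice_harmonic_on_def)

lemma lattice_harmonic_on_subset: "lattice_harmonic_on A F \<Longrightarrow> B \<subseteq> A \<Longrightarrow> lattice_harmonic_on B F"
  by (auto simp only: lattice_harmonic_on_def)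

primrec first_hit_in :: "(int \<times> int) set \<Rightarrow> nat \<Rightarrow> int \<times> int \<Rightarrow> int \<times> int \<Rightarrow> real" where
  "first_hit_in A 0 s t = (if s \<in> A \<and> s = t then 1 else 0)"
| "first_hit_in A (Suc n) s t = (if s \<in> A then 0 else neighbour_mean (\<lambda>s. first_hit_in A n s t) s)"

lemma first_hit_in_nonneg: "0 \<le> first_hit_in A n s t"
  by (induction n arbitrary: s) (auto intro: neighbour_mean_nonneg)

lemma sum_first_hit_in_le_1: "finite T \<Longrightarrow> (\<Sum>n<N. \<Sum>t\<in>T. first_hit_in A n s t) \<le> 1"
proof (induction N arbitrary: s)
  case (Suc N)
  have split: "(\<Sum>n<Suc N. \<Sum>t\<in>T. first_hit_in A n s t)
      = (\<Sum>t\<in>T. first_hit_in A 0 s t) + (\<Sum>n<N. \<Sum>t\<in>T. first_hit_in A (Suc n) s t)"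
    by (rule sum.lessThan_Suc_shift)
  show ?case
  proof (cases "s \<in> A")
    case True
    then show ?thesis unfolding split using Suc.prems by simp
  next
    case False
    then have "(\<Sum>n<N. \<Sum>t\<in>T. first_hit_in A (Suc n) s t)
       = neighbour_mean (\<lambda>s. \<Sum>n<N. \<Sum>t\<in>T. first_hit_in A n s t) s"
      by (simp add: neighbour_mean_sum)
    also have "\<dots> \<le> 1" by (intro neighbour_mean_le Suc.IH Suc.prems)
    finally show ?thesis unfolding split using False by simp
  qed
qed simp

definition hit_prob :: "(int \<times> int) set \<Rightarrow> int \<times> int \<Rightarrow> int \<times> int \<Rightarrow> real" where
  "hit_prob A s t = (\<Sum>n. first_hit_in A n s t)"

lemma hit_prob_sums: "(\<lambda>n. first_hit_in A n s t) sums hit_prob A s t"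
  unfolding hit_prob_def
proof (intro summable_sums summableI_nonneg_bounded first_hit_in_nonneg)
  show "(\<Sum>n<N. first_hit_in A n s t) \<le> 1" for N
    using sum_first_hit_in_le_1[of "{t}" A s N] by simp
qed

lemma hit_prob_nonneg: "0 \<le> hit_prob A s t"
  using sums_le[OF first_hit_in_nonneg sums_zero hit_prob_sums] .

lemma sum_hit_prob_le_1:
  assumes "finite T"
  shows "(\<Sum>t\<in>T. hit_prob A s t) \<le> 1"
proof -
  have "(\<lambda>n. \<Sum>t\<in>T. first_hit_in A n s t) sums (\<Sum>t\<in>T. hit_prob A s t)"
    by (intro sums_sum hit_prob_sums)
  then show ?thesis
    unfolding sums_def by (rule LIMSEQ_le_const2) (use sum_first_hit_in_le_1[OF assms] in blast)
qed

lemma hit_prob_boundary: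
  assumes "s \<in> A"
  shows "hit_prob A s t = (if s = t then 1 else 0)"
proof -
  have "first_hit_in A n s t = 0" if "n \<notin> {0}" for n
    using that assms by (cases n) auto
  then have "hit_prob A s t = (\<Sum>n\<in>{0}. first_hit_in A n s t)"
    unfolding hit_prob_def by (intro suminf_finite) auto
  then show ?thesis using assms by simp
qed

lemma lattice_harmonic_on_hit_prob: "lattice_harmonic_on (- A) (\<lambda>s. hit_prob A s t)"
proof (rule lattice_harmonic_onI)
  fix s assume off_A: "s \<in> - A"
  have "(\<lambda>n. first_hit_in A (Suc n) s t) sums hit_prob A s t"
    using hit_prob_sums[of A s t] off_A by (subst sums_Suc_iff) simp
  moreover have "(\<lambda>n. first_hit_in A (Suc n) s t) sums neighbour_mean (\<lambda>s. hit_prob A s t) s"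
    using sums_neighbour_mean[OF hit_prob_sums, where s = s] off_A by simp
  ultimately show "hit_prob A s t = neighbour_mean (\<lambda>s. hit_prob A s t) s" by (rule sums_unique2)
qed

definition lattice_symmetry :: "(int \<times> int \<Rightarrow> int \<times> int) \<Rightarrow> bool" where
  "lattice_symmetry \<phi> \<longleftrightarrow> inj \<phi>
    \<and> (\<forall>(F :: int \<times> int \<Rightarrow> real) s. neighbour_mean (\<lambda>s. F (\<phi> s)) s = neighbour_mean F (\<phi> s))"

lemma neighbour_mean_symmetry:
  fixes F :: "int \<times> int \<Rightarrow> real"
  assumes "lattice_symmetry \<phi>"
  shows "neighbour_mean F (\<phi> s) = neighbour_mean (\<lambda>s. F (\<phi> s)) s"
  using assms by (simp only: lattice_symmetry_def)

lemma lattice_symmetry_translation: "lattice_symmetry (\<lambda>(i, j). (i + d, j))"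
  by (auto simp: lattice_symmetry_def inj_on_def algebra_simps)

lemma lattice_symmetry_reflection: "lattice_symmetry (\<lambda>(i, j). (i, - j))"
  by (auto simp: lattice_symmetry_def inj_on_def algebra_simps)

lemma hit_prob_symmetry:
  assumes "lattice_symmetry \<phi>" "\<And>s. \<phi> s \<in> A \<longleftrightarrow> s \<in> A"
  shows "hit_prob A (\<phi> s) (\<phi> t) = hit_prob A s t"
proof -
  have "first_hit_in A n (\<phi> s) (\<phi> t) = first_hit_in A n s t" for n
  proof (induction n arbitrary: s)
    case 0
    then show ?case using assms by (auto simp: lattice_symmetry_def inj_eq)
  next
    case (Suc n)
    then show ?case using assms(2) by (simp add: neighbour_mean_symmetry[OF assms(1)])
  qed
  then show ?thesis by (simp add: hit_prob_def)
qed


section \<open>The Poisson kernel of the half-plane\<close>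

definition poisson_kernel :: "int \<Rightarrow> int \<Rightarrow> real" where
  "poisson_kernel j k = hit_prob (UNIV \<times> {0}) (k, j) (0, 0)"

lemma poisson_kernel_nonneg: "0 \<le> poisson_kernel j k"
  by (simp add: poisson_kernel_def hit_prob_nonneg)

lemma poisson_kernel_0: "poisson_kernel 0 k = (if k = 0 then 1 else 0)"
  by (simp add: poisson_kernel_def hit_prob_boundary)

lemma poisson_kernel_translate: "poisson_kernel j k = hit_prob (UNIV \<times> {0}) (0, j) (- k, 0)"
  using hit_prob_symmetry[OF lattice_symmetry_translation, of k "UNIV \<times> {0}" "(0, j)" "(- k, 0)"]
  by (auto simp: poisson_kernel_def)

lemma sum_poisson_kernel_le_1:
  assumes "finite X"
  shows "(\<Sum>k\<in>X. poisson_kernel j k) \<le> 1"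
proof -
  have "(\<Sum>k\<in>X. poisson_kernel j k) = (\<Sum>t\<in>(\<lambda>k. (- k, 0)) ` X. hit_prob (UNIV \<times> {0}) (0, j) t)"
    by (subst sum.reindex) (auto simp: inj_on_def poisson_kernel_translate)
  also have "\<dots> \<le> 1" using assms by (intro sum_hit_prob_le_1) simp
  finally show ?thesis .
qed

lemma summable_on_poisson_kernel: "poisson_kernel j summable_on UNIV"
  by (rule nonneg_bdd_above_summable_on)
    (auto simp: poisson_kernel_nonneg intro!: bdd_aboveI[of _ 1] sum_poisson_kernel_le_1)

lemma infsum_abs_poisson_kernel_le_1: "(\<Sum>\<^sub>\<infinity>k. \<bar>poisson_kernel j k\<bar>) \<le> 1"
  using infsum_le_finite_sums[OF summable_on_poisson_kernel, of j 1]
  by (simp add: poisson_kernel_nonneg sum_poisson_kernel_le_1)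

definition poisson_extension :: "(int \<Rightarrow> 'b::banach) \<Rightarrow> int \<times> int \<Rightarrow> 'b" where
  "poisson_extension v s = convolution (poisson_kernel (snd s)) v (fst s)"

lemma poisson_extension_axis: "poisson_extension v (m, 0) = v m"
  using convolution_delta[of 0 1 v m] by (simp add: poisson_extension_def poisson_kernel_0[abs_def])

lemma bounded_poisson_extension:
  assumes "bounded (range v)"
  shows "bounded (range (poisson_extension v))"
proof -
  obtain M where M_bound: "0 \<le> M" "\<And>k. norm (v k) \<le> M"
    using assms by (metis bounded_iff norm_ge_zero order_trans rangeI)
  have "norm (poisson_extension v s) \<le> M" for s
  proof -
    have "norm (poisson_extension v s) \<le> (\<Sum>\<^sub>\<infinity>k. \<bar>poisson_kernel (snd s) k\<bar>) * M"
      unfolding poisson_extension_def by (intro norm_convolution_le summable_on_poisson_kernel M_bound)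
    also have "\<dots> \<le> 1 * M" by (intro mult_right_mono infsum_abs_poisson_kernel_le_1 M_bound)
    finally show ?thesis by simp
  qed
  then show ?thesis by (intro boundedI) auto
qed

lemma lattice_harmonic_on_poisson_extension:
  assumes bounded: "bounded (range v)"
  shows "lattice_harmonic_on (UNIV \<times> - {0}) (poisson_extension v)"
proof (rule lattice_harmonic_onI)
  fix s :: "int \<times> int" assume "s \<in> UNIV \<times> - {0}"
  then obtain m j where s_eq: "s = (m, j)" and "j \<noteq> 0" by auto
  let ?K = "\<lambda>s k. poisson_kernel (snd s) (fst s - k) *\<^sub>R v k"
  have has_sum_kernel: "(?K s has_sum poisson_extension v s) UNIV" for s
  proof -
    have "(?K s has_sum poisson_extension v s) UNIV
        \<longleftrightarrow> ((\<lambda>k. poisson_kernel (snd s) k *\<^sub>R v (fst s - k)) has_sum poisson_extension v s) UNIV"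
      by (rule has_sum_reindex_bij_witness[of _ "\<lambda>k. fst s - k" "\<lambda>k. fst s - k"]) auto
    then show ?thesis
      unfolding poisson_extension_def using has_sum_convolution[OF summable_on_poisson_kernel bounded]
      by blast
  qed
  have "((\<lambda>k. neighbour_mean (\<lambda>s. ?K s k) (m, j)) has_sum neighbour_mean (poisson_extension v) (m, j)) UNIV"
    unfolding neighbour_mean.simps by (intro has_sum_scaleR has_sum_add has_sum_kernel)
  moreover have "neighbour_mean (\<lambda>s. ?K s k) (m, j) = ?K (m, j) k" for k
  proof -
    have "(m - k, j) \<in> - (UNIV \<times> {0})" using \<open>j \<noteq> 0\<close> by simp
    from lattice_harmonic_onD[OF lattice_harmonic_on_hit_prob this, of "(0, 0)"]
    have "poisson_kernel j (m - k) = neighbour_mean (\<lambda>s. poisson_kernel (snd s) (fst s)) (m - k, j)"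
      by (simp add: poisson_kernel_def)
    then show ?thesis by (simp add: algebra_simps flip: scaleR_add_left)
  qed
  ultimately show "poisson_extension v s = neighbour_mean (poisson_extension v) s"
    using has_sum_kernel[of "(m, j)"] unfolding s_eq by (simp only: has_sum_unique)
qed

lemma bounded_convex_seq_antimono:
  fixes V :: "nat \<Rightarrow> real"
  assumes bound: "\<And>n. V n \<le> M" and convex: "\<And>n. 2 * V (Suc n) \<le> V (Suc (Suc n)) + V n"
  shows "V (Suc n) \<le> V n"
proof (rule ccontr)
  define d where "d = V (Suc n) - V n"
  assume "\<not> V (Suc n) \<le> V n"
  then have "0 < d" by (simp add: d_def)
  have increment: "d \<le> V (Suc (n + i)) - V (n + i)" for i
  proof (induction i)
    case (Suc i)
    then show ?case using convex[of "n + i"] by simp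
  qed (simp add: d_def)
  have growth: "real i * d \<le> V (n + i) - V n" for i
  proof (induction i)
    case (Suc i)
    then show ?case using increment[of i] by (simp add: algebra_simps)
  qed simp
  obtain i where "M - V n < real i * d" using \<open>0 < d\<close> reals_Archimedean3 by blast
  then show False using bound[of "n + i"] growth[of i] by linarith
qed

text \<open>The supremum over each horizontal line is a convex function of the height.\<close>

lemma half_plane_harmonic_eq_0:
  fixes F :: "int \<times> int \<Rightarrow> 'b::real_normed_vector"
  assumes bounded: "bounded (F ` (UNIV \<times> {0..}))" and harmonic: "lattice_harmonic_on (UNIV \<times> {0<..}) F"
    and zero: "\<And>m. F (m, 0) = 0" and "0 \<le> j"
  shows "F (m, j) = 0"
proof -
  define V where "V n = (SUP m. norm (F (m, int n)))" for n
  obtain M where "\<And>s. s \<in> UNIV \<times> {0..} \<Longrightarrow> norm (F s) \<le> M"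
    using bounded unfolding bounded_iff by blast
  then have norm_F: "norm (F (m, int n)) \<le> M" for m n by simp
  have le_V: "norm (F (m, int n)) \<le> V n" for m n
    unfolding V_def by (rule cSUP_upper) (auto intro: bdd_aboveI2 norm_F)
  have convex: "2 * V (Suc n) \<le> V (Suc (Suc n)) + V n" for n
  proof -
    define j where "j = int (Suc n)"
    have "norm (F (m, j)) \<le> (2 * V (Suc n) + V (Suc (Suc n)) + V n) / 4" for m
    proof -
      have "norm (F (m, j)) \<le> neighbour_mean (\<lambda>s. norm (F s)) (m, j)"
        using norm_neighbour_mean_le[of F "(m, j)"] lattice_harmonic_onD[OF harmonic, of "(m, j)"]
        by (simp add: j_def)
      moreover have "norm (F (m + 1, j)) \<le> V (Suc n)" "norm (F (m - 1, j)) \<le> V (Suc n)"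
        "norm (F (m, j + 1)) \<le> V (Suc (Suc n))" "norm (F (m, j - 1)) \<le> V n"
        using le_V[of "m + 1" "Suc n"] le_V[of "m - 1" "Suc n"] le_V[of m "Suc (Suc n)"] le_V[of m n]
        by (simp_all add: j_def add.commute)
      ultimately show ?thesis by simp
    qed
    then have "V (Suc n) \<le> (2 * V (Suc n) + V (Suc (Suc n)) + V n) / 4"
      unfolding V_def[of "Suc n"] by (intro cSUP_least) (auto simp: j_def)
    then show ?thesis by (simp add: field_simps)
  qed
  have "V n \<le> M" for n unfolding V_def by (rule cSUP_least) (auto intro: norm_F)
  then have "antimono V"
    by (intro decseq_SucI bounded_convex_seq_antimono convex)
  then have "V (nat j) \<le> V 0" by (rule antimonoD) simp
  also have "V 0 = 0" by (simp add: V_def zero)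
  finally have "norm (F (m, int (nat j))) \<le> 0" by (rule order_trans[OF le_V])
  then show ?thesis using \<open>0 \<le> j\<close> by simp
qed

lemma half_plane_poisson_representation:
  fixes F :: "int \<times> int \<Rightarrow> 'b::banach"
  assumes bounded: "bounded (range F)" and harmonic: "lattice_harmonic_on (UNIV \<times> {0<..}) F" and "0 \<le> j"
  shows "F (m, j) = poisson_extension (\<lambda>k. F (k, 0)) (m, j)"
proof -
  have axis: "bounded (range (\<lambda>k. F (k, 0)))" by (rule bounded_subset[OF bounded]) auto
  define D where "D s = F s - poisson_extension (\<lambda>k. F (k, 0)) s" for s
  have "D (m, j) = 0"
  proof (rule half_plane_harmonic_eq_0[OF _ _ _ \<open>0 \<le> j\<close>])
    have "bounded ((\<lambda>s. F s - poisson_extension (\<lambda>k. F (k, 0)) s) ` UNIV)"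
      by (intro bounded_minus_comp bounded bounded_poisson_extension axis)
    then show "bounded (D ` (UNIV \<times> {0..}))" by (rule bounded_subset) (auto simp: D_def)
    show "lattice_harmonic_on (UNIV \<times> {0<..}) D"
    proof (rule lattice_harmonic_onI)
      fix s :: "int \<times> int" assume "s \<in> UNIV \<times> {0<..}"
      then show "D s = neighbour_mean D s"
        using lattice_harmonic_onD[OF harmonic, of s]
          lattice_harmonic_onD[OF lattice_harmonic_on_poisson_extension[OF axis], of s]
        by (auto simp: D_def[abs_def] neighbour_mean_diff simp del: neighbour_mean.simps)
    qed
  qed (simp add: D_def poisson_extension_axis)
  then show ?thesis by (simp add: D_def)
qed

definition poisson_root :: "real \<Rightarrow> real" where
  "poisson_root t = ((4 - 2 * cos t) - sqrt ((4 - 2 * cos t)\<^sup>2 - 4)) / 2"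

lemma poisson_root_equation: "(poisson_root t)\<^sup>2 + 1 = (4 - 2 * cos t) * poisson_root t"
proof -
  define A where "A = 4 - 2 * cos t"
  have "2\<^sup>2 \<le> A\<^sup>2" using cos_le_one[of t] by (intro power_mono) (auto simp: A_def)
  then have "(sqrt (A\<^sup>2 - 4))\<^sup>2 = A\<^sup>2 - 4" by simp
  moreover have "((A - r) / 2)\<^sup>2 + 1 = A * ((A - r) / 2)" if "r\<^sup>2 = A\<^sup>2 - 4" for r
    using that by (simp add: power2_eq_square field_simps)
  ultimately show ?thesis unfolding poisson_root_def A_def by blast
qed

lemma poisson_root_bounds: "0 \<le> poisson_root t" "poisson_root t \<le> 1"
proof -
  define A where "A = 4 - 2 * cos t"
  have "2 \<le> A" using cos_le_one[of t] by (simp add: A_def)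
  then have "sqrt (A\<^sup>2 - 4) \<le> A" by (intro real_le_lsqrt) auto
  moreover have "A - 2 \<le> sqrt (A\<^sup>2 - 4)"
    using \<open>2 \<le> A\<close> by (intro real_le_rsqrt) (simp add: power2_eq_square algebra_simps)
  ultimately show "0 \<le> poisson_root t" "poisson_root t \<le> 1" by (simp_all add: poisson_root_def A_def)
qed

lemma fourier_poisson_kernel: "fourier (poisson_kernel (int n)) t = of_real (poisson_root t ^ n)"
proof -
  define r where "r = poisson_root t"
  define F where "F s = of_real (r ^ nat (snd s)) * cis (of_int (fst s) * t)" for s :: "int \<times> int"
  have "F (0, int n) = poisson_extension (\<lambda>k. F (k, 0)) (0, int n)"
  proof (rule half_plane_poisson_representation)
    have "norm (F s) \<le> 1" for s
      using poisson_root_bounds[of t] by (simp add: F_def norm_mult norm_power r_def power_le_one)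
    then show "bounded (range F)" by (intro boundedI) auto
    show "lattice_harmonic_on (UNIV \<times> {0<..}) F"
    proof (rule lattice_harmonic_onI)
      fix s :: "int \<times> int" assume "s \<in> UNIV \<times> {0<..}"
      then obtain m n where s_eq: "s = (m, int (Suc n))"
        by (cases s) (auto dest!: zero_less_imp_eq_int gr0_implies_Suc)
      define j where "j = int (Suc n)"
      then have heights: "nat (j + 1) = Suc (Suc n)" "nat j = Suc n" "nat (j - 1) = n" by (auto simp: j_def)
      define \<chi> \<rho> where "\<chi> k = cis (of_int k * t)" and "\<rho> = complex_of_real r" for k :: int
      have "neighbour_mean F (m, j)
        = (1/4) *\<^sub>R ((\<chi> (m + 1) + \<chi> (m - 1)) * \<rho> ^ Suc n + \<chi> m * (\<rho> ^ Suc (Suc n) + \<rho> ^ n))"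
        unfolding neighbour_mean.simps F_def fst_conv snd_conv heights \<chi>_def \<rho>_def of_real_power
        by (simp only: ring_distribs mult_ac add_ac)
      also have "\<chi> (m + 1) + \<chi> (m - 1) = of_real (2 * cos t) * \<chi> m"
        by (simp add: \<chi>_def complex_eq_iff distrib_right left_diff_distrib cos_add cos_diff sin_add sin_diff)
      also have "\<rho> ^ Suc (Suc n) + \<rho> ^ n = of_real ((4 - 2 * cos t) * r) * \<rho> ^ n"
        unfolding r_def \<rho>_def poisson_root_equation[symmetric] by (simp add: power2_eq_square algebra_simps)
      finally show "F s = neighbour_mean F s"
        unfolding s_eq j_def[symmetric]
        by (simp add: F_def heights \<chi>_def \<rho>_def scaleR_conv_of_real algebra_simps)
    qed
  qed simp
  then show ?thesis
    using convolution_cis[of "poisson_kernel (int n)" t 0] by (simp add: F_def poisson_extension_def r_def)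
qed


section \<open>Wiener--Hopf factorisation of the trace on the axis\<close>

text \<open>The law of the displacement between successive visits of the walk to the horizontal axis.\<close>

definition axis_step :: "int \<Rightarrow> real" where
  "axis_step k = ((if k = 1 then 1 else 0) + (if k = - 1 then 1 else 0) + 2 * poisson_kernel 1 k) / 4"

lemma axis_step_nonneg: "0 \<le> axis_step k"
  by (simp add: axis_step_def poisson_kernel_nonneg)

lemma axis_step_1_pos: "0 < axis_step 1"
  using poisson_kernel_nonneg[of 1 1] by (simp add: axis_step_def)

lemma has_sum_convolution_axis_step:
  fixes v :: "int \<Rightarrow> 'b::banach"
  assumes "bounded (range v)"
  shows "((\<lambda>k. axis_step k *\<^sub>R v (m - k))
    has_sum (1/4) *\<^sub>R (v (m - 1) + v (m + 1) + 2 *\<^sub>R poisson_extension v (m, 1))) UNIV"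
proof -
  have "((\<lambda>k. (1/4) *\<^sub>R ((if k = 1 then 1 else 0) *\<^sub>R v (m - k) + (if k = - 1 then 1 else 0) *\<^sub>R v (m - k)
      + 2 *\<^sub>R (poisson_kernel 1 k *\<^sub>R v (m - k))))
    has_sum (1/4) *\<^sub>R (1 *\<^sub>R v (m - 1) + 1 *\<^sub>R v (m - (- 1)) + 2 *\<^sub>R convolution (poisson_kernel 1) v m))
      UNIV"
    by (intro has_sum_scaleR has_sum_add has_sum_delta has_sum_convolution summable_on_poisson_kernel assms)
  moreover have "(1/4) *\<^sub>R ((if k = 1 then 1 else 0) *\<^sub>R x + (if k = - 1 then 1 else 0) *\<^sub>R x
      + 2 *\<^sub>R (poisson_kernel 1 k *\<^sub>R x)) = axis_step k *\<^sub>R x" for k and x :: 'b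
    by (simp only: axis_step_def scaleR_scaleR flip: scaleR_add_left) simp
  ultimately show ?thesis by (simp add: poisson_extension_def)
qed

lemma convolution_axis_step:
  fixes v :: "int \<Rightarrow> 'b::banach"
  assumes "bounded (range v)"
  shows "convolution axis_step v m = (1/4) *\<^sub>R (v (m - 1) + v (m + 1) + 2 *\<^sub>R poisson_extension v (m, 1))"
  unfolding convolution_def by (rule infsumI[OF has_sum_convolution_axis_step[OF assms]])

lemma poisson_extension_const: "0 \<le> j \<Longrightarrow> poisson_extension (\<lambda>_. c) (m, j) = c"
  using half_plane_poisson_representation[of "\<lambda>_. c" j m]
  by (auto simp: lattice_harmonic_on_def neighbour_mean_const simp del: neighbour_mean.simps)

lemma has_sum_axis_step: "(axis_step has_sum 1) UNIV"
  using has_sum_convolution_axis_step[of "\<lambda>_. 1 :: real" 0] by (simp add: poisson_extension_const)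

lemma summable_on_axis_step: "axis_step summable_on UNIV"
  by (rule has_sum_imp_summable[OF has_sum_axis_step])

lemma fourier_axis_step: "fourier axis_step t = of_real (1 - sqrt ((4 - 2 * cos t)\<^sup>2 - 4) / 4)"
proof -
  define \<chi> where "\<chi> k = cis (of_int k * t)" for k
  have "fourier axis_step t = convolution axis_step \<chi> 0"
    by (simp add: \<chi>_def[abs_def] convolution_cis)
  also have "\<dots> = (1/4) *\<^sub>R (\<chi> (-1) + \<chi> 1 + 2 *\<^sub>R poisson_extension \<chi> (0, 1))"
    using convolution_axis_step[of \<chi> 0] by (simp add: \<chi>_def[abs_def] bounded_range_cis)
  also have "poisson_extension \<chi> (0, 1) = of_real (poisson_root t)"
    using fourier_poisson_kernel[of 1 t] by (simp add: poisson_extension_def \<chi>_def[abs_def] convolution_cis)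
  also have "\<chi> (-1) + \<chi> 1 = of_real (2 * cos t)"
    by (simp add: \<chi>_def complex_eq_iff)
  also have "(1/4) *\<^sub>R (of_real (2 * cos t) + 2 *\<^sub>R of_real (poisson_root t))
    = complex_of_real ((2 * cos t + 2 * poisson_root t) / 4)"
    by (simp add: scaleR_conv_of_real)
  also have "(2 * cos t + 2 * poisson_root t) / 4 = 1 - sqrt ((4 - 2 * cos t)\<^sup>2 - 4) / 4"
    by (simp add: poisson_root_def field_simps)
  finally show ?thesis .
qed

lemma cmod_fps_value_sqrt_fps_cis:
  "(cmod (fps_value sqrt_fps (cis t)))\<^sup>2 = (sqrt 2 - 1) * sqrt ((4 - 2 * cos t)\<^sup>2 - 4)"
proof -
  have expand: "(1 - c * a)\<^sup>2 + (- (s * a))\<^sup>2 = 1 - 2 * a * c + a\<^sup>2 * (c\<^sup>2 + s\<^sup>2)" for a c s :: real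
    by (simp add: power2_eq_square algebra_simps)
  have dist: "(cmod (1 - cis t * of_real a))\<^sup>2 = 1 - 2 * a * cos t + a\<^sup>2" for a
    unfolding cmod_power2 using expand[of "cos t" a "sin t"] by simp
  have "(cmod (fps_value sqrt_fps (cis t)))\<^sup>2
    = cmod (1 - cis t * of_real 1) * cmod (1 - cis t * of_real alpha)"
    by (simp add: fps_value_sqrt_fps norm_mult)
  also have "\<dots> = sqrt ((cmod (1 - cis t * of_real 1))\<^sup>2 * (cmod (1 - cis t * of_real alpha))\<^sup>2)"
    by (simp add: real_sqrt_mult)
  also have "(cmod (1 - cis t * of_real 1))\<^sup>2 * (cmod (1 - cis t * of_real alpha))\<^sup>2
      = (2 - 2 * cos t) * (alpha * (6 - 2 * cos t))"
    unfolding dist alpha_square by (simp add: algebra_simps)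
  also have "\<dots> = alpha * ((4 - 2 * cos t)\<^sup>2 - 4)" by (simp add: power2_eq_square algebra_simps)
  also have "sqrt \<dots> = (sqrt 2 - 1) * sqrt ((4 - 2 * cos t)\<^sup>2 - 4)" by (simp add: real_sqrt_mult alpha_def)
  finally show ?thesis .
qed

abbreviation reflected_coeff :: "real fps \<Rightarrow> int \<Rightarrow> real" where
  "reflected_coeff f \<equiv> (\<lambda>k. int_coeff f (- k))"

lemma summable_on_reflected_coeff:
  assumes "fps_abs_conv f (1 :: real)"
  shows "reflected_coeff f summable_on UNIV"
  using summable_on_reindex_bij_betw[OF bij_uminus, of "int_coeff f"] summable_on_int_coeff[OF assms] by blast

lemma summable_on_sqrt_coeff: "int_coeff sqrt_fps summable_on UNIV"
  and summable_on_reflected_sqrt_coeff: "reflected_coeff sqrt_fps summable_on UNIV"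
  by (simp_all only: summable_on_int_coeff summable_on_reflected_coeff fps_abs_conv_sqrt_fps norm_one
    order_refl)

lemma axis_step_factorization:
  "(if k = 0 then 1 else 0)
    = axis_step k + (sqrt 2 + 1) / 4 * convolution (reflected_coeff sqrt_fps) (int_coeff sqrt_fps) k"
proof (rule fourier_inject)
  let ?W = "convolution (reflected_coeff sqrt_fps) (int_coeff sqrt_fps)"
  show "(\<lambda>k::int. if k = 0 then 1 else 0 :: real) summable_on UNIV" by (rule summable_on_delta)
  have summable_W: "(\<lambda>k. (sqrt 2 + 1) / 4 * ?W k) summable_on UNIV"
    by (intro summable_on_cmult_right summable_on_convolution summable_on_sqrt_coeff
      summable_on_reflected_sqrt_coeff)
  then show "(\<lambda>k. axis_step k + (sqrt 2 + 1) / 4 * ?W k) summable_on UNIV"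
    by (intro summable_on_add summable_on_axis_step)
  fix t
  define r where "r = sqrt ((4 - 2 * cos t)\<^sup>2 - 4)"
  have "fourier ?W t = cnj (fps_value sqrt_fps (cis (- t))) * fps_value sqrt_fps (cis (- t))"
    by (simp only: fourier_convolution summable_on_sqrt_coeff summable_on_reflected_sqrt_coeff fourier_reflect
        fourier_int_coeff fps_abs_conv_sqrt_fps norm_one order_refl)
  also have "\<dots> = of_real ((cmod (fps_value sqrt_fps (cis (- t))))\<^sup>2)"
    using complex_norm_square[of "fps_value sqrt_fps (cis (- t))"] by (simp add: mult.commute)
  also have "\<dots> = of_real ((sqrt 2 - 1) * r)" by (simp only: cmod_fps_value_sqrt_fps_cis r_def cos_minus)
  finally have fourier_W: "fourier ?W t = of_real ((sqrt 2 - 1) * r)" .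
  have "(sqrt 2 + 1) * (sqrt 2 - 1) = (1 :: real)" by (simp add: algebra_simps)
  then have "1 = (1 - r / 4) + (sqrt 2 + 1) / 4 * ((sqrt 2 - 1) * r)" by (simp flip: mult.assoc)
  then show "fourier (\<lambda>k. if k = 0 then 1 else 0) t = fourier (\<lambda>k. axis_step k + (sqrt 2 + 1) / 4 * ?W k) t"
    unfolding fourier_add[OF summable_on_axis_step summable_W] fourier_cmult fourier_W fourier_delta
      fourier_axis_step r_def[symmetric]
      of_real_mult[symmetric] of_real_add[symmetric] by (metis of_real_1)
qed

lemma axis_defect_factorization:
  fixes v :: "int \<Rightarrow> 'b::banach"
  assumes bounded: "bounded (range v)"
  shows "v m - convolution axis_step v m
    = ((sqrt 2 + 1) / 4) *\<^sub>R convolution (reflected_coeff sqrt_fps) (convolution (int_coeff sqrt_fps) v) m"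
proof -
  let ?W = "convolution (reflected_coeff sqrt_fps) (int_coeff sqrt_fps)"
  have summable_W: "?W summable_on UNIV"
    by (rule summable_on_convolution[OF summable_on_reflected_sqrt_coeff summable_on_sqrt_coeff])
  have "v m = convolution (\<lambda>k. if k = 0 then 1 else 0) v m" by (simp add: convolution_delta)
  also have "\<dots> = convolution (\<lambda>k. axis_step k + (sqrt 2 + 1) / 4 * ?W k) v m"
    by (simp only: axis_step_factorization[symmetric])
  also have "\<dots> = convolution axis_step v m + ((sqrt 2 + 1) / 4) *\<^sub>R convolution ?W v m"
    by (simp only: convolution_add_left summable_on_axis_step summable_on_cmult_right summable_W
      bounded convolution_cmult_left)
  also have "convolution ?W v m
    = convolution (reflected_coeff sqrt_fps) (convolution (int_coeff sqrt_fps) v) m"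
    by (rule convolution_assoc[symmetric, OF summable_on_reflected_sqrt_coeff summable_on_sqrt_coeff bounded])
  finally show ?thesis by simp
qed

definition geometric_fps :: "real \<Rightarrow> real fps" where
  "geometric_fps x = Abs_fps (\<lambda>n. x ^ n)"

lemma fps_abs_conv_geometric_fps: "norm x < 1 \<Longrightarrow> fps_abs_conv (geometric_fps x) (1 :: real)"
  by (simp add: fps_abs_conv_def geometric_fps_def power_abs)

text \<open>\<open>axis_gf x m / S(x)\<close> is the coefficient of \<open>w\<^sup>m\<close> in \<open>1 / (S(w) (1 - x/w))\<close>, where \<open>S\<close> is the function
  with the power series \<open>sqrt_fps\<close>.\<close>

definition axis_gf :: "real \<Rightarrow> int \<Rightarrow> real" where
  "axis_gf x m
    = fps_value sqrt_fps x * convolution (reflected_coeff (geometric_fps x)) (int_coeff rsqrt_fps) m"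

lemma bounded_rsqrt_coeff: "bounded (range (int_coeff rsqrt_fps))"
  using rsqrt_fps_tendsto_0 by (intro bounded_int_coeff convergent_imp_Bseq convergentI)

context
  fixes x :: real
  assumes x_in_unit: "0 < x" "x < 1"
begin

lemma summable_on_reflected_geometric: "reflected_coeff (geometric_fps x) summable_on UNIV"
  using x_in_unit by (intro summable_on_reflected_coeff fps_abs_conv_geometric_fps) simp

lemma bounded_axis_gf: "bounded (range (axis_gf x))"
  using bounded_scaleR_comp[OF
    bounded_convolution[OF summable_on_reflected_geometric bounded_rsqrt_coeff], of "fps_value sqrt_fps x"]
  by (simp add: axis_gf_def[abs_def])

lemma axis_gf_tendsto_0: "(\<lambda>n. axis_gf x (int n)) \<longlonglongrightarrow> 0"
proof -
  let ?g = "reflected_coeff (geometric_fps x)"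
  define G where "G = (\<Sum>\<^sub>\<infinity>k. \<bar>?g k\<bar>)"
  have "(\<lambda>n. convolution ?g (int_coeff rsqrt_fps) (int n)) \<longlonglongrightarrow> 0"
  proof (rule LIMSEQ_I)
    fix e :: real assume "0 < e"
    have "0 \<le> G" unfolding G_def by (rule infsum_nonneg) simp
    then have "0 < e / (G + 1)" using \<open>0 < e\<close> by simp
    then obtain N where coeff_le: "\<And>n. n \<ge> N \<Longrightarrow> \<bar>rsqrt_fps $ n\<bar> \<le> e / (G + 1)"
      using LIMSEQ_D[OF rsqrt_fps_tendsto_0] by (metis diff_zero less_imp_le real_norm_def)
    have "norm (convolution ?g (int_coeff rsqrt_fps) (int n) - 0) < e" if "n \<ge> N" for n
    proof -
      have "norm (convolution ?g (int_coeff rsqrt_fps) (int n)) \<le> (\<Sum>\<^sub>\<infinity>k. \<bar>?g k\<bar>) * (e / (G + 1))"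
        by (rule norm_convolution_le[OF summable_on_reflected_geometric])
          (use coeff_le that in \<open>auto simp: le_nat_iff split: if_splits\<close>)
      also have "\<dots> = G * (e / (G + 1))" by (simp only: G_def)
      also have "\<dots> < e" using \<open>0 \<le> G\<close> \<open>0 < e\<close> by (simp add: field_simps)
      finally show ?thesis by simp
    qed
    then show "\<exists>N. \<forall>n\<ge>N. norm (convolution ?g (int_coeff rsqrt_fps) (int n) - 0) < e" by blast
  qed
  then show ?thesis unfolding axis_gf_def by (rule tendsto_mult_right_zero)
qed

lemma reflected_geometric_recurrence:
  "reflected_coeff (geometric_fps x) k = (if k = 0 then 1 else 0)
    + x * reflected_coeff (geometric_fps x) (k + 1)"
proof (cases k rule: int_cases3)
  case (neg n)
  then have "nat (- k) = Suc (nat (- (k + 1)))" by simp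
  then have "x ^ nat (- k) = x * x ^ nat (- (k + 1))" by (simp only: power_Suc)
  then show ?thesis using neg by (simp add: geometric_fps_def)
qed (simp_all add: geometric_fps_def)

lemma axis_gf_recurrence: "axis_gf x m = x * axis_gf x (m + 1) + fps_value sqrt_fps x * int_coeff rsqrt_fps m"
proof -
  let ?g = "reflected_coeff (geometric_fps x)" and ?R = "int_coeff rsqrt_fps"
  have summable_shift: "(\<lambda>k. ?g (k + 1)) summable_on UNIV"
    using summable_on_reindex_bij_betw[OF bij_plus_right[of 1], of ?g] summable_on_reflected_geometric
    by blast
  have "convolution ?g ?R m = convolution (\<lambda>k. (if k = 0 then 1 else 0) + x * ?g (k + 1)) ?R m"
    by (simp only: reflected_geometric_recurrence[symmetric])
  also have "\<dots> = ?R m + x * convolution ?g ?R (m + 1)"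
    by (simp only: convolution_add_left summable_on_delta summable_on_cmult_right summable_shift
      bounded_rsqrt_coeff
        convolution_cmult_left convolution_delta convolution_shift[of ?g]) simp
  finally show ?thesis by (simp add: axis_gf_def distrib_left)
qed

lemma axis_gf_0: "axis_gf x 0 = 1"
proof -
  let ?g = "reflected_coeff (geometric_fps x)" and ?R = "int_coeff rsqrt_fps"
  have "fps_abs_conv rsqrt_fps x" using x_in_unit by (intro fps_abs_conv_rsqrt_fps) simp
  then have "((\<lambda>n. rsqrt_fps $ n * x ^ n) has_sum fps_value rsqrt_fps x) UNIV"
    using fps_value_real_sums[of rsqrt_fps x]
    by (intro norm_summable_imp_has_sum) (auto simp: fps_abs_conv_def)
  then have "((\<lambda>n. (rsqrt_fps $ n) *\<^sub>R int_coeff (geometric_fps x) (int n))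
    has_sum fps_value rsqrt_fps x) UNIV"
    by (simp add: geometric_fps_def)
  then have "((\<lambda>k. ?R k *\<^sub>R ?g (0 - k)) has_sum fps_value rsqrt_fps x) UNIV"
    by (simp only: has_sum_int_coeff_iff diff_0 minus_minus)
  then have "convolution ?g ?R 0 = fps_value rsqrt_fps x"
    unfolding convolution_commute[of ?g] unfolding convolution_def by (rule infsumI)
  then show ?thesis using x_in_unit by (simp add: axis_gf_def fps_value_rsqrt_fps)
qed

lemma axis_gf_nonpos: "axis_gf x (- int n) = x ^ n"
proof (induction n)
  case (Suc n)
  have "- int (Suc n) + 1 = - int n" by simp
  then show ?case using axis_gf_recurrence[of "- int (Suc n)"] Suc by simp
qed (simp add: axis_gf_0)

lemma axis_gf_nonneg: "x ^ n * axis_gf x (int n) = 1 - fps_value sqrt_fps x * (\<Sum>l<n. rsqrt_fps $ l * x ^ l)"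
proof (induction n)
  case (Suc n)
  have "x ^ Suc n * axis_gf x (int (Suc n)) = x ^ n * axis_gf x (int n)
    - fps_value sqrt_fps x * (rsqrt_fps $ n * x ^ n)"
    using axis_gf_recurrence[of "int n"] by (simp add: algebra_simps)
  then show ?case by (simp only: Suc sum.lessThan_Suc ring_distribs diff_diff_eq)
qed (simp add: axis_gf_0)

lemma axis_gf_defect:
  "axis_gf x m - convolution axis_step (axis_gf x) m
    = (sqrt 2 + 1) / 4 * fps_value sqrt_fps x * int_coeff (sqrt_fps * geometric_fps x) (- m)"
proof -
  let ?g = "reflected_coeff (geometric_fps x)" and ?S = "int_coeff sqrt_fps" and ?R = "int_coeff rsqrt_fps"
  note assoc = convolution_assoc[OF _ _ bounded_rsqrt_coeff]
  have sqrt_rsqrt: "convolution ?S ?R = (\<lambda>k. if k = 0 then 1 else 0)"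
    unfolding convolution_int_coeff sqrt_fps_times_rsqrt_fps by auto
  have "convolution ?S (convolution ?g ?R) = ?g"
  proof
    fix n
    have "convolution ?S (convolution ?g ?R) n = convolution (convolution ?S ?g) ?R n"
      by (rule assoc[OF summable_on_sqrt_coeff summable_on_reflected_geometric])
    also have "\<dots> = convolution (convolution ?g ?S) ?R n" by (simp only: ext[OF convolution_commute[of ?S ?g]])
    also have "\<dots> = convolution ?g (convolution ?S ?R) n"
      by (rule assoc[symmetric, OF summable_on_reflected_geometric summable_on_sqrt_coeff])
    also have "\<dots> = convolution (\<lambda>k. if k = 0 then 1 else 0) ?g n"
      unfolding sqrt_rsqrt by (rule convolution_commute)
    finally show "convolution ?S (convolution ?g ?R) n = ?g n" by (simp add: convolution_delta)
  qed
  then have convolution_axis_gf: "convolution ?S (axis_gf x) = (\<lambda>k. fps_value sqrt_fps x * ?g k)"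
    by (simp only: axis_gf_def[abs_def] convolution_cmult_right[abs_def])
  have "convolution (reflected_coeff sqrt_fps) ?g m = int_coeff (sqrt_fps * geometric_fps x) (- m)"
    by (simp only: convolution_reflect convolution_int_coeff)
  then show ?thesis
    unfolding axis_defect_factorization[OF bounded_axis_gf] convolution_axis_gf
    by (simp only: convolution_cmult_right) simp
qed

lemma axis_gf_harmonic: "0 < m \<Longrightarrow> axis_gf x m = convolution axis_step (axis_gf x) m"
  using axis_gf_defect[of m] by simp

end

lemma eventually_at_left_1: "eventually (\<lambda>x::real. 0 < x \<and> x < 1) (at_left 1)"
  unfolding eventually_at_left[OF zero_less_one] by (auto intro!: exI[of _ 0])

lemma fps_value_sqrt_fps_tendsto_0: "(fps_value sqrt_fps \<longlongrightarrow> 0) (at_left (1 :: real))"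
proof (rule Lim_transform_eventually)
  have "((\<lambda>x. sqrt (1 - x) * sqrt (1 - alpha * x)) \<longlongrightarrow> sqrt (1 - 1) * sqrt (1 - alpha * 1)) (at_left 1)"
    by (intro tendsto_intros)
  then show "((\<lambda>x. sqrt (1 - x) * sqrt (1 - alpha * x)) \<longlongrightarrow> 0) (at_left 1)" by simp
  show "eventually (\<lambda>x. sqrt (1 - x) * sqrt (1 - alpha * x) = fps_value sqrt_fps x) (at_left 1)"
    using eventually_at_left_1 by eventually_elim (simp add: fps_value_sqrt_fps_real)
qed

lemma axis_gf_tendsto_1: "((\<lambda>x. axis_gf x m) \<longlongrightarrow> 1) (at_left 1)"
proof (cases m rule: int_cases2)
  case (nonpos n)
  have "((\<lambda>x::real. x ^ n) \<longlongrightarrow> 1 ^ n) (at_left 1)" by (intro tendsto_intros)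
  moreover have "eventually (\<lambda>x. x ^ n = axis_gf x m) (at_left 1)"
    using eventually_at_left_1 by eventually_elim (simp add: nonpos axis_gf_nonpos)
  ultimately show ?thesis by (simp add: Lim_transform_eventually)
next
  case (nonneg n)
  have "((\<lambda>x::real. (1 - fps_value sqrt_fps x * (\<Sum>l<n. rsqrt_fps $ l * x ^ l)) / x ^ n)
      \<longlongrightarrow> (1 - 0 * (\<Sum>l<n. rsqrt_fps $ l * 1 ^ l)) / 1 ^ n) (at_left 1)"
    by (intro tendsto_intros fps_value_sqrt_fps_tendsto_0) simp
  moreover have "eventually
    (\<lambda>x. (1 - fps_value sqrt_fps x * (\<Sum>l<n. rsqrt_fps $ l * x ^ l)) / x ^ n = axis_gf x m) (at_left 1)"
    using eventually_at_left_1 by eventually_elim (simp add: nonneg flip: axis_gf_nonneg)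
  ultimately show ?thesis by (simp add: Lim_transform_eventually)
qed


section \<open>Uniqueness on the axis\<close>

lemma random_walk_max_principle:
  fixes p w :: "int \<Rightarrow> real"
  assumes p_nonneg: "\<And>k. 0 \<le> p k" and p_sum: "(p has_sum 1) UNIV" and p_1: "0 < p 1"
    and bounded: "bounded (range w)"
    and boundary: "\<And>m. m \<le> 0 \<Longrightarrow> w m \<le> 0"
    and infinity: "eventually (\<lambda>n. w (int n) \<le> 0) sequentially"
    and subharmonic: "\<And>m. 0 < m \<Longrightarrow> w m \<le> convolution p w m"
  shows "w m \<le> 0"
proof (rule ccontr)
  assume "\<not> w m \<le> 0"
  then have "0 < w m" by simp
  obtain N where far_nonpos: "\<And>n. n \<ge> N \<Longrightarrow> w (int n) \<le> 0"
    using infinity unfolding eventually_sequentially by blast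
  have inside: "k \<in> {0<..<int N}" if "0 < w k" for k
    using boundary[of k] far_nonpos[of "nat k"] that by force
  define B where "B = Max (w ` {0<..<int N})"
  have "w m \<le> B" unfolding B_def using inside[OF \<open>0 < w m\<close>] by (intro Max_ge) auto
  then have "0 < B" using \<open>0 < w m\<close> by simp
  have le_B: "w k \<le> B" for k
  proof (cases "0 < w k")
    case True
    then show ?thesis unfolding B_def using inside[of k] by (intro Max_ge) auto
  qed (use \<open>0 < B\<close> in simp)
  have "B \<in> w ` {0<..<int N}"
    unfolding B_def using inside[OF \<open>0 < w m\<close>] by (intro Max_in) auto
  then obtain k where "w k = B" by blast
  have step_left: "w (k - 1) = B" if "w k = B" for k
  proof -
    have "((\<lambda>i. p i * B + - (p i *\<^sub>R w (k - i))) has_sum 1 * B + - convolution p w k) UNIV"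
      by (intro has_sum_add has_sum_uminusI has_sum_cmult_left p_sum has_sum_convolution
        has_sum_imp_summable[OF p_sum] bounded)
    then have "(\<Sum>i\<in>{1}. p i * B + - (p i *\<^sub>R w (k - i))) \<le> 1 * B + - convolution p w k"
      by (rule finite_sum_le_has_sum) (auto intro: mult_left_mono p_nonneg le_B)
    also have "\<dots> \<le> 0" using subharmonic[of k] inside[of k] \<open>w k = B\<close> \<open>0 < B\<close> by simp
    finally have "p 1 * (B - w (k - 1)) \<le> 0" by (simp add: right_diff_distrib)
    then have "B \<le> w (k - 1)" using p_1 by (simp add: mult_le_0_iff)
    then show ?thesis using le_B[of "k - 1"] by simp
  qed
  have "w (k - int i) = B" for i
  proof (induction i)
    case (Suc i)
    have "k - int (Suc i) = k - int i - 1" by simp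
    then show ?case using step_left[OF Suc] by (simp only:)
  qed (simp add: \<open>w k = B\<close>)
  from this[of "nat k"] show False using boundary[of "k - int (nat k)"] \<open>0 < B\<close> by linarith
qed

text \<open>\<open>1 - axis_gf x\<close> is nonnegative on the slit, tends to 1 at infinity, and tends to 0 pointwise as \<open>x \<rightarrow> 1\<close>.
  This barrier takes the place of the recurrence of the walk.\<close>

definition axis_barrier :: "real \<Rightarrow> int \<Rightarrow> real" where
  "axis_barrier x m = 1 - axis_gf x m"

lemma axis_barrier_tendsto_0: "((\<lambda>x. axis_barrier x m) \<longlongrightarrow> 0) (at_left 1)"
  using tendsto_diff[OF tendsto_const axis_gf_tendsto_1, of 1 m] by (simp add: axis_barrier_def)

context
  fixes x :: real
  assumes x_in_unit: "0 < x" "x < 1"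
begin

lemma bounded_axis_barrier: "bounded (range (axis_barrier x))"
  unfolding axis_barrier_def[abs_def] by (intro bounded_minus_comp bounded_axis_gf x_in_unit) simp

lemma axis_barrier_nonneg:
  assumes "m \<le> 0"
  shows "0 \<le> axis_barrier x m"
proof -
  obtain n where "m = - int n" using assms by (rule nonpos_int_cases)
  then show ?thesis using x_in_unit by (simp add: axis_barrier_def axis_gf_nonpos power_le_one)
qed

lemma axis_barrier_tendsto_1: "(\<lambda>n. axis_barrier x (int n)) \<longlonglongrightarrow> 1"
  using tendsto_diff[OF tendsto_const axis_gf_tendsto_0[OF x_in_unit], of 1] by (simp add: axis_barrier_def)

lemma axis_barrier_harmonic:
  assumes "0 < m"
  shows "axis_barrier x m = convolution axis_step (axis_barrier x) m"
  unfolding axis_barrier_def[abs_def]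
  using axis_gf_harmonic[OF x_in_unit assms] convolution_axis_step[of "\<lambda>_. 1 :: real" m]
  by (subst convolution_diff_right)
    (simp_all add: summable_on_axis_step bounded_axis_gf[OF x_in_unit] poisson_extension_const)

lemma axis_harmonic_le_barrier:
  fixes v :: "int \<Rightarrow> real"
  assumes bound: "\<And>m. \<bar>v m\<bar> \<le> M" and boundary: "\<And>m. m \<le> 0 \<Longrightarrow> v m \<le> 0"
    and harmonic: "\<And>m. 0 < m \<Longrightarrow> v m = convolution axis_step v m"
  shows "v m \<le> (M + 1) * axis_barrier x m"
proof -
  have "0 \<le> M" using bound[of 0] by linarith
  define w where "w m = v m - (M + 1) *\<^sub>R axis_barrier x m" for m
  have bounded_v: "bounded (range v)" using bound by (intro boundedI[of _ M]) auto
  have bounded_multiple: "bounded (range (\<lambda>m. (M + 1) *\<^sub>R axis_barrier x m))"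
    by (rule bounded_scaleR_comp[OF bounded_axis_barrier])
  have "w m \<le> 0"
  proof (rule random_walk_max_principle[OF axis_step_nonneg has_sum_axis_step axis_step_1_pos])
    show "bounded (range w)" unfolding w_def by (intro bounded_minus_comp bounded_v bounded_multiple)
    show "w m \<le> 0" if "m \<le> 0" for m
      using boundary[OF that] axis_barrier_nonneg[OF that] \<open>0 \<le> M\<close>
      by (simp add: w_def mult_nonneg_nonneg order_trans)
    have "(\<lambda>n. (M + 1) *\<^sub>R axis_barrier x (int n)) \<longlonglongrightarrow> (M + 1) *\<^sub>R 1"
      by (intro tendsto_intros axis_barrier_tendsto_1)
    then have "eventually (\<lambda>n. M < (M + 1) *\<^sub>R axis_barrier x (int n)) sequentially"
      by (rule order_tendstoD) simp
    then show "eventually (\<lambda>n. w (int n) \<le> 0) sequentially"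
    proof eventually_elim
      case (elim n)
      then show ?case using bound[of "int n"] by (simp add: w_def)
    qed
    show "w m \<le> convolution axis_step w m" if "0 < m" for m
      using harmonic[OF that] axis_barrier_harmonic[OF that] unfolding w_def
      by (simp only: convolution_diff_right summable_on_axis_step bounded_v bounded_multiple
          convolution_scaleR_right order_refl)
  qed
  then show ?thesis by (simp add: w_def)
qed

end

lemma axis_harmonic_nonpos:
  fixes v :: "int \<Rightarrow> real"
  assumes bounded: "bounded (range v)" and boundary: "\<And>m. m \<le> 0 \<Longrightarrow> v m \<le> 0"
    and harmonic: "\<And>m. 0 < m \<Longrightarrow> v m = convolution axis_step v m"
  shows "v m \<le> 0"
proof -
  obtain M where bound: "\<And>m. \<bar>v m\<bar> \<le> M" using bounded by (auto simp: bounded_iff)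
  have "((\<lambda>x. (M + 1) * axis_barrier x m) \<longlongrightarrow> (M + 1) * 0) (at_left 1)"
    by (intro tendsto_intros axis_barrier_tendsto_0)
  moreover have "eventually (\<lambda>x. v m \<le> (M + 1) * axis_barrier x m) (at_left 1)"
    using eventually_at_left_1
    by eventually_elim (intro axis_harmonic_le_barrier bound boundary harmonic, auto)
  ultimately have "v m \<le> (M + 1) * 0" by (rule tendsto_lowerbound) simp
  then show ?thesis by simp
qed

lemma axis_harmonic_eq_0:
  fixes v :: "int \<Rightarrow> real"
  assumes bounded: "bounded (range v)" and boundary: "\<And>m. m \<le> 0 \<Longrightarrow> v m = 0"
    and harmonic: "\<And>m. 0 < m \<Longrightarrow> v m = convolution axis_step v m"
  shows "v m = 0"
proof -
  have "v m \<le> 0"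
    by (rule axis_harmonic_nonpos[OF bounded _ harmonic]) (simp add: boundary)
  moreover have "(-1) *\<^sub>R v m \<le> 0"
  proof (rule axis_harmonic_nonpos)
    show "bounded (range (\<lambda>m. (-1) *\<^sub>R v m))" by (rule bounded_scaleR_comp[OF bounded])
    show "(-1) *\<^sub>R v m \<le> 0" if "m \<le> 0" for m using boundary[OF that] by simp
    show "(-1) *\<^sub>R v m = convolution axis_step (\<lambda>m. (-1) *\<^sub>R v m) m" if "0 < m" for m
      unfolding convolution_scaleR_right using harmonic[OF that] by simp
  qed
  ultimately show ?thesis by simp
qed


section \<open>Generating functions of the hitting probabilities of the slit\<close>

lemma first_hit_eq_first_hit_in: "first_hit n s t = first_hit_in Hset n s t"
  by (induction n arbitrary: s) (auto split: prod.split)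

lemma hitp_eq_hit_prob: "hitp i j k = hit_prob Hset (i, j) (- int k, 0)"
  by (simp add: hitp_def hit_prob_def first_hit_eq_first_hit_in)

lemma mem_Hset_iff: "(i, j) \<in> Hset \<longleftrightarrow> i \<le> 0 \<and> j = 0"
  by (auto simp: Hset_def)

definition hit_fps :: "int \<times> int \<Rightarrow> real fps" where
  "hit_fps s = Abs_fps (\<lambda>k. hit_prob Hset s (- int k, 0))"

lemma hit_fps_nth: "hit_fps (i, j) $ k = hitp i j k"
  by (simp add: hit_fps_def hitp_eq_hit_prob)

lemma hit_fps_nth_nonneg: "0 \<le> hit_fps s $ k"
  by (simp add: hit_fps_def hit_prob_nonneg)

lemma sum_hit_fps_le_1: "(\<Sum>k<K. hit_fps s $ k) \<le> 1"
proof -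
  have "(\<Sum>k<K. hit_fps s $ k) = (\<Sum>t\<in>(\<lambda>k. (- int k, 0)) ` {..<K}. hit_prob Hset s t)"
    by (subst sum.reindex) (auto simp: inj_on_def hit_fps_def)
  also have "\<dots> \<le> 1" by (rule sum_hit_prob_le_1) simp
  finally show ?thesis .
qed

lemma summable_hit_fps: "summable (\<lambda>k. hit_fps s $ k)"
  by (rule summableI_nonneg_bounded[OF hit_fps_nth_nonneg sum_hit_fps_le_1])

lemma fps_abs_conv_hit_fps: "norm z \<le> 1 \<Longrightarrow> fps_abs_conv (hit_fps s) z"
  by (rule fps_abs_conv_mono[of _ "1 :: real"])
    (simp_all add: fps_abs_conv_1_iff hit_fps_nth_nonneg summable_hit_fps)

lemma hit_fps_nth_harmonic: "lattice_harmonic_on (- Hset) (\<lambda>s. hit_fps s $ k)"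
  unfolding hit_fps_def fps_nth_Abs_fps by (rule lattice_harmonic_on_hit_prob)

lemma hit_fps_boundary: "hit_fps (- int n, 0) = fps_X ^ n"
  by (rule fps_ext) (auto simp: hit_fps_def hit_prob_boundary mem_Hset_iff fps_X_power_nth)

lemma hit_fps_reflect: "hit_fps (i, - j) = hit_fps (i, j)"
proof (rule fps_ext)
  fix k
  have "(\<lambda>(i, j). (i, - j)) s \<in> Hset \<longleftrightarrow> s \<in> Hset" for s
    by (cases s) (simp add: mem_Hset_iff)
  then show "hit_fps (i, - j) $ k = hit_fps (i, j) $ k"
    using hit_prob_symmetry[OF lattice_symmetry_reflection, of Hset "(i, j)" "(- int k, 0)"]
    by (simp add: hit_fps_def)
qed

definition hit_gf :: "real \<Rightarrow> int \<times> int \<Rightarrow> real" where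
  "hit_gf x s = fps_value (hit_fps s) x"

lemma hit_gf_reflect: "hit_gf x (i, - j) = hit_gf x (i, j)"
  by (simp add: hit_gf_def hit_fps_reflect)

context
  fixes x :: real
  assumes x_in_unit: "0 < x" "x < 1"
begin

lemma hit_gf_sums: "(\<lambda>k. hit_fps s $ k * x ^ k) sums hit_gf x s"
  unfolding hit_gf_def using x_in_unit by (intro fps_value_real_sums fps_abs_conv_hit_fps) simp

lemma hit_gf_nonneg: "0 \<le> hit_gf x s"
  using x_in_unit by (intro sums_le[OF _ sums_zero hit_gf_sums]) (simp add: hit_fps_nth_nonneg)

lemma hit_gf_le_1: "hit_gf x s \<le> 1"
proof -
  have "hit_gf x s \<le> (\<Sum>k. hit_fps s $ k)"
    using x_in_unit by (intro sums_le[OF _ hit_gf_sums summable_sums[OF summable_hit_fps]])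
      (simp add: mult_left_le power_le_one hit_fps_nth_nonneg)
  also have "\<dots> \<le> 1" by (rule suminf_le_const[OF summable_hit_fps sum_hit_fps_le_1])
  finally show ?thesis .
qed

lemma bounded_hit_gf: "bounded (range (hit_gf x))"
  using hit_gf_nonneg hit_gf_le_1 by (intro boundedI[of _ 1]) auto

lemma hit_gf_harmonic: "lattice_harmonic_on (- Hset) (hit_gf x)"
proof (rule lattice_harmonic_onI)
  fix s assume off_slit: "s \<in> - Hset"
  have "(\<lambda>k. neighbour_mean (\<lambda>s. hit_fps s $ k * x ^ k) s) sums neighbour_mean (hit_gf x) s"
    by (rule sums_neighbour_mean[OF hit_gf_sums])
  moreover have "neighbour_mean (\<lambda>s. hit_fps s $ k * x ^ k) s = hit_fps s $ k * x ^ k" for k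
    unfolding lattice_harmonic_onD[OF hit_fps_nth_harmonic off_slit, of k]
    by (cases s) (simp add: algebra_simps)
  ultimately show "hit_gf x s = neighbour_mean (hit_gf x) s"
    using hit_gf_sums[of s] by (simp only: sums_unique2)
qed

lemma hit_gf_row_1: "hit_gf x (m, 1) = poisson_extension (\<lambda>k. hit_gf x (k, 0)) (m, 1)"
proof (rule half_plane_poisson_representation[OF bounded_hit_gf])
  show "lattice_harmonic_on (UNIV \<times> {0<..}) (hit_gf x)"
    by (rule lattice_harmonic_on_subset[OF hit_gf_harmonic]) (auto simp: mem_Hset_iff)
qed simp

lemma bounded_hit_gf_axis: "bounded (range (\<lambda>k. hit_gf x (k, 0)))"
  by (rule bounded_subset[OF bounded_hit_gf]) auto

lemma convolution_axis_step_hit_gf: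
  "convolution axis_step (\<lambda>k. hit_gf x (k, 0)) m
    = (hit_gf x (m + 1, 0) + hit_gf x (m - 1, 0) + 2 * hit_gf x (m, 1)) / 4"
  by (simp add: convolution_axis_step bounded_hit_gf_axis flip: hit_gf_row_1)

lemma hit_gf_axis: "hit_gf x (m, 0) = axis_gf x m"
proof -
  define v where "v m = hit_gf x (m, 0) - axis_gf x m" for m
  have "v m = 0"
  proof (rule axis_harmonic_eq_0)
    show "bounded (range v)"
      unfolding v_def by (intro bounded_minus_comp bounded_hit_gf_axis bounded_axis_gf x_in_unit)
    show "v m = 0" if "m \<le> 0" for m
    proof -
      obtain n where "m = - int n" using \<open>m \<le> 0\<close> by (rule nonpos_int_cases)
      then show ?thesis
        by (simp add: v_def hit_gf_def hit_fps_boundary fps_value_X_power axis_gf_nonpos x_in_unit)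
    qed
    show "v m = convolution axis_step v m" if "0 < m" for m
    proof -
      have "(m, 0) \<in> - Hset" using that by (simp add: mem_Hset_iff)
      then have "hit_gf x (m, 0) = convolution axis_step (\<lambda>k. hit_gf x (k, 0)) m"
        using lattice_harmonic_onD[OF hit_gf_harmonic] hit_gf_reflect[of x m 1]
        by (simp add: convolution_axis_step_hit_gf)
      then show ?thesis
        unfolding v_def using axis_gf_harmonic[OF x_in_unit that]
        by (simp add: convolution_diff_right summable_on_axis_step bounded_hit_gf_axis bounded_axis_gf
          x_in_unit)
    qed
  qed
  then show ?thesis by (simp add: v_def)
qed

lemma hit_gf_row_1_eq:
  "2 * hit_gf x (m, 1) = 4 * hit_gf x (m, 0) - hit_gf x (m + 1, 0) - hit_gf x (m - 1, 0)
    - (sqrt 2 + 1) * fps_value sqrt_fps x * int_coeff (sqrt_fps * geometric_fps x) (- m)"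
  using axis_gf_defect[OF x_in_unit, of m] convolution_axis_step_hit_gf[of m]
  by (simp add: hit_gf_axis field_simps)

end


section \<open>Algebraic form of the generating functions\<close>

lemma Rats_subset_QSqrt2: "r \<in> \<rat> \<Longrightarrow> r \<in> QSqrt2"
  unfolding QSqrt2_def by (elim Rats_cases, intro CollectI, rule exI, rule exI[of _ 0]) simp

lemma sqrt_2_in_QSqrt2: "sqrt 2 \<in> QSqrt2"
  unfolding QSqrt2_def by (rule CollectI, rule exI[of _ 0], rule exI[of _ 1]) simp

lemma QSqrt2_add:
  assumes "x \<in> QSqrt2" "y \<in> QSqrt2"
  shows "x + y \<in> QSqrt2"
proof -
  obtain a b c d :: rat where "x = of_rat a + of_rat b * sqrt 2" "y = of_rat c + of_rat d * sqrt 2"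
    using assms by (auto simp: QSqrt2_def)
  then have "x + y = of_rat (a + c) + of_rat (b + d) * sqrt 2"
    by (simp add: of_rat_add algebra_simps)
  then show ?thesis unfolding QSqrt2_def by blast
qed

lemma QSqrt2_mult:
  assumes "x \<in> QSqrt2" "y \<in> QSqrt2"
  shows "x * y \<in> QSqrt2"
proof -
  obtain a b c d :: rat where "x = of_rat a + of_rat b * sqrt 2" "y = of_rat c + of_rat d * sqrt 2"
    using assms by (auto simp: QSqrt2_def)
  then have "x * y = of_rat (a * c + 2 * b * d) + of_rat (a * d + b * c) * sqrt 2"
    by (simp add: of_rat_add of_rat_mult algebra_simps)
  then show ?thesis unfolding QSqrt2_def by blast
qed

lemma QSqrt2_uminus: "x \<in> QSqrt2 \<Longrightarrow> - x \<in> QSqrt2"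
  using QSqrt2_mult[OF Rats_subset_QSqrt2[of "-1"]] by simp

lemma QSqrt2_0: "0 \<in> QSqrt2" and QSqrt2_1: "1 \<in> QSqrt2"
  by (simp_all add: Rats_subset_QSqrt2)

lemma QSqrt2_sum: "(\<And>x. x \<in> A \<Longrightarrow> f x \<in> QSqrt2) \<Longrightarrow> sum f A \<in> QSqrt2"
  by (induction A rule: infinite_finite_induct) (auto simp: QSqrt2_0 QSqrt2_add)

lemma QSqrt2_power: "x \<in> QSqrt2 \<Longrightarrow> x ^ n \<in> QSqrt2"
  by (induction n) (auto simp: QSqrt2_1 QSqrt2_mult)

lemma alpha_in_QSqrt2: "alpha \<in> QSqrt2"
  using QSqrt2_add[OF Rats_subset_QSqrt2[of 3] QSqrt2_mult[OF Rats_subset_QSqrt2[of "-2"] sqrt_2_in_QSqrt2]]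
  by (simp add: alpha_eq)

lemma gbinomial_in_Rats:
  fixes c :: real
  assumes "c \<in> \<rat>"
  shows "c gchoose n \<in> \<rat>"
proof (induction n)
  case (Suc n)
  then show ?case
    unfolding gbinomial_Suc_rec using assms by (intro Rats_mult Rats_divide Rats_diff) auto
qed simp

lemma binom_fps_nth_in_QSqrt2: "c \<in> \<rat> \<Longrightarrow> a \<in> QSqrt2 \<Longrightarrow> binom_fps c a $ n \<in> QSqrt2"
  unfolding binom_fps_nth
  by (rule QSqrt2_mult[OF Rats_subset_QSqrt2[OF gbinomial_in_Rats]]) (auto intro: QSqrt2_power QSqrt2_uminus)

lemma sqrt_fps_nth_in_QSqrt2: "sqrt_fps $ n \<in> QSqrt2"
  and rsqrt_fps_nth_in_QSqrt2: "rsqrt_fps $ n \<in> QSqrt2"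
  unfolding sqrt_fps_def rsqrt_fps_def fps_mult_nth
  by (intro QSqrt2_sum QSqrt2_mult binom_fps_nth_in_QSqrt2 QSqrt2_1 alpha_in_QSqrt2; simp)+

definition laurent_sqrt_repr :: "nat \<Rightarrow> real poly \<Rightarrow> real poly \<Rightarrow> real fps \<Rightarrow> bool" where
  "laurent_sqrt_repr N P Q f \<longleftrightarrow> (\<forall>n. coeff P n \<in> \<rat>) \<and> (\<forall>n. coeff Q n \<in> QSqrt2) \<and>
     fps_X ^ N * f = fps_of_poly P - fps_of_poly Q * sqrt_fps"

lemma laurent_sqrt_repr_add:
  assumes "laurent_sqrt_repr N P Q f" "laurent_sqrt_repr M P' Q' g"
  shows "laurent_sqrt_repr (N + M) (monom 1 M * P + monom 1 N * P') (monom 1 M * Q + monom 1 N * Q') (f + g)"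
  unfolding laurent_sqrt_repr_def
proof (intro conjI allI)
  show "coeff (monom 1 M * P + monom 1 N * P') n \<in> \<rat>" for n
    using assms by (auto simp: laurent_sqrt_repr_def coeff_monom_mult)
  show "coeff (monom 1 M * Q + monom 1 N * Q') n \<in> QSqrt2" for n
    using assms by (auto simp: laurent_sqrt_repr_def coeff_monom_mult intro!: QSqrt2_add QSqrt2_0)
  have "fps_X ^ (N + M) * (f + g) = fps_X ^ M * (fps_X ^ N * f) + fps_X ^ N * (fps_X ^ M * g)"
    by (simp add: power_add algebra_simps)
  also have "\<dots> = fps_X ^ M * (fps_of_poly P - fps_of_poly Q * sqrt_fps)
      + fps_X ^ N * (fps_of_poly P' - fps_of_poly Q' * sqrt_fps)"
    using assms by (simp only: laurent_sqrt_repr_def)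
  finally show "fps_X ^ (N + M) * (f + g) = fps_of_poly (monom 1 M * P + monom 1 N * P')
      - fps_of_poly (monom 1 M * Q + monom 1 N * Q') * sqrt_fps"
    by (simp add: fps_of_poly_add fps_of_poly_mult fps_of_poly_monom algebra_simps)
qed

lemma laurent_sqrt_repr_cmult:
  assumes "laurent_sqrt_repr N P Q f" "c \<in> \<rat>"
  shows "laurent_sqrt_repr N (smult c P) (smult c Q) (fps_const c * f)"
  unfolding laurent_sqrt_repr_def
proof (intro conjI allI)
  show "coeff (smult c P) n \<in> \<rat>" for n
    using assms by (auto simp: laurent_sqrt_repr_def)
  show "coeff (smult c Q) n \<in> QSqrt2" for n
    using assms by (auto simp: laurent_sqrt_repr_def intro: QSqrt2_mult Rats_subset_QSqrt2)
  have "fps_X ^ N * (fps_const c * f) = fps_const c * (fps_X ^ N * f)" by (simp add: mult_ac)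
  also have "\<dots> = fps_const c * (fps_of_poly P - fps_of_poly Q * sqrt_fps)"
    using assms(1) by (simp only: laurent_sqrt_repr_def)
  finally show "fps_X ^ N * (fps_const c * f) = fps_of_poly (smult c P) - fps_of_poly (smult c Q) * sqrt_fps"
    by (simp add: fps_of_poly_smult algebra_simps)
qed

definition has_laurent_sqrt_repr :: "real \<Rightarrow> real fps \<Rightarrow> bool" where
  "has_laurent_sqrt_repr c f \<longleftrightarrow> (\<exists>N P Q. laurent_sqrt_repr N P Q f \<and> poly P 1 = c)"

lemma has_laurent_sqrt_repr_add:
  assumes "has_laurent_sqrt_repr c f" "has_laurent_sqrt_repr d g"
  shows "has_laurent_sqrt_repr (c + d) (f + g)"
proof -
  obtain N P Q M P' Q'
    where "laurent_sqrt_repr N P Q f" "poly P 1 = c" "laurent_sqrt_repr M P' Q' g" "poly P' 1 = d"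
    using assms by (auto simp: has_laurent_sqrt_repr_def)
  moreover from this have "poly (monom 1 M * P + monom 1 N * P') 1 = c + d" by (simp add: poly_monom)
  ultimately show ?thesis
    unfolding has_laurent_sqrt_repr_def using laurent_sqrt_repr_add by blast
qed

lemma has_laurent_sqrt_repr_cmult:
  assumes "has_laurent_sqrt_repr c f" "r \<in> \<rat>"
  shows "has_laurent_sqrt_repr (r * c) (fps_const r * f)"
proof -
  obtain N P Q where "laurent_sqrt_repr N P Q f" "poly P 1 = c"
    using assms(1) by (auto simp: has_laurent_sqrt_repr_def)
  moreover from this have "poly (smult r P) 1 = r * c" by simp
  ultimately show ?thesis
    unfolding has_laurent_sqrt_repr_def using laurent_sqrt_repr_cmult assms(2) by blast
qed

lemma has_laurent_sqrt_repr_diff: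
  assumes "has_laurent_sqrt_repr c f" "has_laurent_sqrt_repr d g"
  shows "has_laurent_sqrt_repr (c - d) (f - g)"
proof -
  have "has_laurent_sqrt_repr (c + -1 * d) (f + fps_const (-1) * g)"
    by (intro has_laurent_sqrt_repr_add has_laurent_sqrt_repr_cmult assms) simp
  then show ?thesis by (simp flip: fps_const_neg)
qed

lemma poly_truncate_fps:
  fixes f :: "'a::comm_ring_1 fps"
  shows "poly (truncate_fps n f) x = (\<Sum>l<n. f $ l * x ^ l)"
proof -
  have "truncate_fps n f = (\<Sum>l<n. monom (f $ l) l)"
    by (rule poly_eqI) (simp add: coeff_truncate_fps coeff_sum)
  then show ?thesis by (simp add: poly_sum poly_monom)
qed

lemma laurent_sqrt_repr_hit_fps_axis_nonneg:
  "laurent_sqrt_repr n 1 (truncate_fps n rsqrt_fps) (hit_fps (int n, 0))"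
  unfolding laurent_sqrt_repr_def
proof (intro conjI allI)
  show "coeff 1 k \<in> (\<rat> :: real set)" for k by (simp add: coeff_1)
  show "coeff (truncate_fps n rsqrt_fps) k \<in> QSqrt2" for k
    by (simp add: coeff_truncate_fps rsqrt_fps_nth_in_QSqrt2 QSqrt2_0)
  let ?Q = "fps_of_poly (truncate_fps n rsqrt_fps)"
  show "fps_X ^ n * hit_fps (int n, 0) = fps_of_poly 1 - ?Q * sqrt_fps"
  proof (rule fps_eqI_value[where r = 1])
    have conv: "fps_abs_conv (fps_X ^ n) x" "fps_abs_conv (hit_fps (int n, 0)) x"
      "fps_abs_conv (fps_of_poly 1) x" "fps_abs_conv ?Q x" "fps_abs_conv sqrt_fps x"
      if "norm x \<le> 1" for x :: real
      using that
      by (simp_all only: fps_abs_conv_X_power fps_abs_conv_hit_fps fps_abs_conv_of_poly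
        fps_abs_conv_sqrt_fps)
    show "fps_abs_conv (fps_X ^ n * hit_fps (int n, 0)) (1::real)"
      "fps_abs_conv (fps_of_poly 1 - ?Q * sqrt_fps) (1::real)"
      by (intro fps_abs_conv_mult fps_abs_conv_diff conv; simp)+
    fix x :: real assume x_in_unit: "0 < x" "x < 1"
    then have norm_le: "norm x \<le> 1" by simp
    have "fps_value (fps_X ^ n * hit_fps (int n, 0)) x = x ^ n * hit_gf x (int n, 0)"
      by (simp only: fps_value_mult conv[OF norm_le] fps_value_X_power hit_gf_def)
    also have "\<dots> = 1 - fps_value sqrt_fps x * (\<Sum>l<n. rsqrt_fps $ l * x ^ l)"
      using x_in_unit by (simp add: hit_gf_axis axis_gf_nonneg)
    also have "\<dots> = fps_value (fps_of_poly 1 - ?Q * sqrt_fps) x"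
      by (simp only: fps_value_diff fps_value_mult fps_abs_conv_mult conv[OF norm_le] fps_value_of_poly
          map_poly_of_real_real poly_truncate_fps) simp
    finally show "fps_value (fps_X ^ n * hit_fps (int n, 0)) x = fps_value (fps_of_poly 1 - ?Q * sqrt_fps) x" .
  qed simp
qed

lemma has_laurent_sqrt_repr_hit_fps_axis: "has_laurent_sqrt_repr 1 (hit_fps (m, 0))"
proof (cases m rule: int_cases2)
  case (nonneg n)
  then show ?thesis
    unfolding has_laurent_sqrt_repr_def using laurent_sqrt_repr_hit_fps_axis_nonneg[of n] by (metis poly_1)
next
  case (nonpos n)
  have "laurent_sqrt_repr 0 (monom 1 n) 0 (hit_fps (m, 0))"
    by (simp add: laurent_sqrt_repr_def nonpos hit_fps_boundary QSqrt2_0 fps_of_poly_monom)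
  then show ?thesis unfolding has_laurent_sqrt_repr_def by (metis poly_monom power_one mult_1)
qed

definition axis_defect_poly :: "int \<Rightarrow> real poly" where
  "axis_defect_poly m = (if m \<le> 0
     then smult (sqrt 2 + 1) (\<Sum>i\<le>nat (- m). monom (sqrt_fps $ i) (nat (- m) - i)) else 0)"

lemma poly_axis_defect_poly:
  "poly (axis_defect_poly m) x = (sqrt 2 + 1) * int_coeff (sqrt_fps * geometric_fps x) (- m)"
  by (auto simp: axis_defect_poly_def poly_sum poly_monom fps_mult_nth geometric_fps_def atLeast0AtMost)

lemma coeff_axis_defect_poly_in_QSqrt2: "coeff (axis_defect_poly m) n \<in> QSqrt2"
proof -
  have "coeff (monom (sqrt_fps $ i) k) n \<in> QSqrt2" for i k
    by (simp add: coeff_monom sqrt_fps_nth_in_QSqrt2 QSqrt2_0)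
  then show ?thesis
    unfolding axis_defect_poly_def
    by (auto simp: coeff_sum QSqrt2_0 intro!: QSqrt2_mult QSqrt2_add QSqrt2_sum sqrt_2_in_QSqrt2 QSqrt2_1)
qed

lemma hit_fps_row_1:
  "fps_const 2 * hit_fps (m, 1) = fps_const 4 * hit_fps (m, 0) - hit_fps (m + 1, 0) - hit_fps (m - 1, 0)
    - fps_of_poly (axis_defect_poly m) * sqrt_fps"
proof (rule fps_eqI_value[where r = 1])
  let ?D = "fps_of_poly (axis_defect_poly m)"
  let ?L = "fps_const 2 * hit_fps (m, 1)"
  let ?R = "fps_const 4 * hit_fps (m, 0) - hit_fps (m + 1, 0) - hit_fps (m - 1, 0) - ?D * sqrt_fps"
  have conv: "fps_abs_conv (fps_const c) x" "fps_abs_conv (hit_fps s) x" "fps_abs_conv ?D x"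
    "fps_abs_conv sqrt_fps x"
    if "norm x \<le> 1" for x :: real and c s
    using that
    by (simp_all only: fps_abs_conv_const fps_abs_conv_hit_fps fps_abs_conv_of_poly fps_abs_conv_sqrt_fps)
  show "fps_abs_conv ?L (1::real)" "fps_abs_conv ?R (1::real)"
    by (intro fps_abs_conv_mult fps_abs_conv_diff conv; simp)+
  fix x :: real assume x_in_unit: "0 < x" "x < 1"
  then have norm_le: "norm x \<le> 1" by simp
  have "fps_value ?L x = 2 * hit_gf x (m, 1)"
    by (simp only: fps_value_mult conv[OF norm_le] fps_value_const hit_gf_def) simp
  also have "\<dots> = 4 * hit_gf x (m, 0) - hit_gf x (m + 1, 0) - hit_gf x (m - 1, 0)
      - poly (axis_defect_poly m) x * fps_value sqrt_fps x"
    unfolding hit_gf_row_1_eq[OF x_in_unit] poly_axis_defect_poly by (simp only: mult_ac)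
  also have "\<dots> = fps_value ?R x"
    by (simp only: fps_value_diff fps_value_mult fps_abs_conv_mult fps_abs_conv_diff conv[OF norm_le]
      fps_value_const
        fps_value_of_poly map_poly_of_real_real hit_gf_def) simp
  finally show "fps_value ?L x = fps_value ?R x" .
qed simp

lemma has_laurent_sqrt_repr_poly_times_sqrt:
  assumes "\<And>n. coeff Q n \<in> QSqrt2"
  shows "has_laurent_sqrt_repr 0 (fps_of_poly Q * sqrt_fps)"
proof -
  have "laurent_sqrt_repr 0 0 (- Q) (fps_of_poly Q * sqrt_fps)"
    using assms by (simp add: laurent_sqrt_repr_def fps_of_poly_uminus QSqrt2_uminus)
  then show ?thesis unfolding has_laurent_sqrt_repr_def by (metis poly_0)
qed

lemma has_laurent_sqrt_repr_hit_fps_row_1: "has_laurent_sqrt_repr 1 (hit_fps (m, 1))"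
proof -
  have "has_laurent_sqrt_repr (4 * 1 - 1 - 1 - 0) (fps_const 2 * hit_fps (m, 1))"
    unfolding hit_fps_row_1
    by (intro has_laurent_sqrt_repr_diff has_laurent_sqrt_repr_cmult has_laurent_sqrt_repr_hit_fps_axis
        has_laurent_sqrt_repr_poly_times_sqrt coeff_axis_defect_poly_in_QSqrt2) simp
  then have "has_laurent_sqrt_repr (1/2 * (4 * 1 - 1 - 1 - 0))
    (fps_const (1/2) * (fps_const 2 * hit_fps (m, 1)))"
    by (rule has_laurent_sqrt_repr_cmult) simp
  then show ?thesis by (simp flip: mult.assoc)
qed

lemma hit_fps_next_row:
  assumes "0 < j"
  shows "hit_fps (i, j + 1) = fps_const 4 * hit_fps (i, j) - hit_fps (i + 1, j) - hit_fps (i - 1, j)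
    - hit_fps (i, j - 1)"
proof (rule fps_ext)
  fix k
  have "(i, j) \<in> - Hset" using assms by (simp add: mem_Hset_iff)
  from lattice_harmonic_onD[OF hit_fps_nth_harmonic this, of k]
  show "hit_fps (i, j + 1) $ k
      = (fps_const 4 * hit_fps (i, j) - hit_fps (i + 1, j) - hit_fps (i - 1, j) - hit_fps (i, j - 1)) $ k"
    by simp
qed

lemma has_laurent_sqrt_repr_hit_fps_upper:
  "has_laurent_sqrt_repr 1 (hit_fps (i, int n)) \<and> has_laurent_sqrt_repr 1 (hit_fps (i, int n + 1))"
proof (induction n arbitrary: i)
  case 0
  then show ?case by (simp add: has_laurent_sqrt_repr_hit_fps_axis has_laurent_sqrt_repr_hit_fps_row_1)
next
  case (Suc n)
  have "has_laurent_sqrt_repr (4 * 1 - 1 - 1 - 1) (fps_const 4 * hit_fps (i, int n + 1)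
      - hit_fps (i + 1, int n + 1) - hit_fps (i - 1, int n + 1) - hit_fps (i, int n))"
    using Suc by (intro has_laurent_sqrt_repr_diff has_laurent_sqrt_repr_cmult) auto
  then show ?case using Suc[of i] hit_fps_next_row[of "int n + 1" i] by (simp add: add.commute)
qed

theorem has_laurent_sqrt_repr_hit_fps: "has_laurent_sqrt_repr 1 (hit_fps (i, j))"
proof (cases j rule: int_cases2)
  case (nonneg n)
  then show ?thesis using has_laurent_sqrt_repr_hit_fps_upper by blast
next
  case (nonpos n)
  then show ?thesis using has_laurent_sqrt_repr_hit_fps_upper[of i n] by (simp add: hit_fps_reflect)
qed

lemma laurent_sqrt_repr_hit_fps_1_0: "laurent_sqrt_repr 1 1 1 (hit_fps (1, 0))"
proof -
  have "truncate_fps 1 rsqrt_fps = 1"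
    by (rule poly_eqI) (auto simp: coeff_truncate_fps rsqrt_fps_nth_0)
  then show ?thesis using laurent_sqrt_repr_hit_fps_axis_nonneg[of 1] by simp
qed

lemma laurent_sqrt_repr_value:
  assumes "laurent_sqrt_repr N P Q f" "fps_abs_conv f z" "norm z \<le> 1"
  shows "z ^ N * fps_value f z = poly (map_poly of_real P) z
    - poly (map_poly of_real Q) z * fps_value sqrt_fps z"
proof -
  have "z ^ N * fps_value f z = fps_value (fps_X ^ N * f) z"
    using assms by (simp add: fps_value_mult fps_abs_conv_X_power fps_value_X_power)
  also have "\<dots> = fps_value (fps_of_poly P - fps_of_poly Q * sqrt_fps) z"
    using assms(1) by (simp only: laurent_sqrt_repr_def)
  also have "\<dots> = poly (map_poly of_real P) z - poly (map_poly of_real Q) z * fps_value sqrt_fps z"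
    using assms(3)
    by (simp add: fps_value_diff fps_value_mult fps_abs_conv_mult fps_abs_conv_of_poly
      fps_abs_conv_sqrt_fps fps_value_of_poly)
  finally show ?thesis .
qed


section \<open>The limit of the rescaled generating functions\<close>

lemma poly_over_sqrt_fps_tendsto_0:
  fixes p :: "real poly"
  assumes "poly p 1 = 0"
  shows "((\<lambda>x. poly p x / fps_value sqrt_fps x) \<longlongrightarrow> 0) (at_left 1)"
proof -
  obtain q where p_eq: "p = [:-1, 1:] * q" using assms unfolding poly_eq_0_iff_dvd by (auto elim: dvdE)
  have "((\<lambda>x. - (sqrt (1 - x) / sqrt (1 - alpha * x)) * poly q x) \<longlongrightarrow>
    - (sqrt (1 - 1) / sqrt (1 - alpha * 1)) * poly q 1) (at_left 1)"
    using alpha_less_1 by (intro tendsto_intros) auto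
  moreover have "eventually
    (\<lambda>x. - (sqrt (1 - x) / sqrt (1 - alpha * x)) * poly q x = poly p x / fps_value sqrt_fps x) (at_left 1)"
    using eventually_at_left_1
  proof eventually_elim
    case (elim x)
    define r where "r = sqrt (1 - x)"
    have r_root: "0 < r" "r * r = 1 - x" using elim by (simp_all add: r_def)
    have "poly p x = - (r * r) * poly q x" unfolding r_root(2) by (simp add: p_eq algebra_simps)
    then show ?case using elim r_root(1) by (simp add: fps_value_sqrt_fps_real flip: r_def)
  qed
  ultimately show ?thesis by (simp add: Lim_transform_eventually)
qed

lemma laurent_sqrt_repr_limit:
  assumes repr: "laurent_sqrt_repr N P Q f" and conv: "fps_abs_conv f (1 :: real)" and "poly P 1 = 1"
  shows "((\<lambda>x. (1 - fps_value f x) / fps_value sqrt_fps x) \<longlongrightarrow> poly Q 1) (at_left 1)"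
proof -
  have "poly (monom 1 N - P) 1 = 0" using assms(3) by (simp add: poly_monom)
  then have "((\<lambda>x. (poly (monom 1 N - P) x / fps_value sqrt_fps x + poly Q x) / x ^ N)
    \<longlongrightarrow> (0 + poly Q 1) / 1 ^ N) (at_left 1)"
    by (intro tendsto_intros poly_over_sqrt_fps_tendsto_0) auto
  moreover have "eventually (\<lambda>x. (poly (monom 1 N - P) x / fps_value sqrt_fps x + poly Q x) / x ^ N
      = (1 - fps_value f x) / fps_value sqrt_fps x) (at_left 1)"
    using eventually_at_left_1
  proof eventually_elim
    case (elim x)
    have "x ^ N * fps_value f x = poly P x - poly Q x * fps_value sqrt_fps x"
      using laurent_sqrt_repr_value[OF repr fps_abs_conv_mono[OF conv], of x] elim
      by (simp add: map_poly_of_real_real)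
    then have "poly (monom 1 N - P) x + poly Q x * fps_value sqrt_fps x = x ^ N * (1 - fps_value f x)"
      by (simp add: poly_monom algebra_simps)
    moreover have "poly (monom 1 N - P) x / fps_value sqrt_fps x + poly Q x
        = (poly (monom 1 N - P) x + poly Q x * fps_value sqrt_fps x) / fps_value sqrt_fps x"
      using fps_value_sqrt_fps_pos[of x] elim by (simp add: add_divide_distrib)
    ultimately show ?case using elim by simp
  qed
  ultimately show ?thesis by (simp add: Lim_transform_eventually)
qed

definition decay_const :: "int \<times> int \<Rightarrow> real" where
  "decay_const s = Lim (at_left 1) (\<lambda>x. (1 - hit_gf x s) / fps_value sqrt_fps x)"

lemma decay_const_eq:
  assumes "laurent_sqrt_repr N P Q (hit_fps s)" "poly P 1 = 1"
  shows "decay_const s = poly Q 1"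
  unfolding decay_const_def hit_gf_def
  using assms by (intro tendsto_Lim laurent_sqrt_repr_limit fps_abs_conv_hit_fps) auto

lemma decay_const_tendsto: "((\<lambda>x. (1 - hit_gf x s) / fps_value sqrt_fps x) \<longlongrightarrow> decay_const s) (at_left 1)"
proof -
  obtain N P Q where "laurent_sqrt_repr N P Q (hit_fps s)" "poly P 1 = 1"
    using has_laurent_sqrt_repr_hit_fps[of "fst s" "snd s"] by (auto simp: has_laurent_sqrt_repr_def)
  then show ?thesis
    unfolding decay_const_eq[OF \<open>laurent_sqrt_repr N P Q (hit_fps s)\<close> \<open>poly P 1 = 1\<close>] hit_gf_def
    by (intro laurent_sqrt_repr_limit fps_abs_conv_hit_fps) auto
qed

lemma decay_const_nonneg: "0 \<le> decay_const s"
proof (rule tendsto_lowerbound[OF decay_const_tendsto])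
  show "eventually (\<lambda>x. 0 \<le> (1 - hit_gf x s) / fps_value sqrt_fps x) (at_left 1)"
    using eventually_at_left_1
  proof eventually_elim
    case (elim x)
    then show ?case using hit_gf_le_1[of x s] fps_value_sqrt_fps_pos[of x] by simp
  qed
qed simp

lemma decay_const_harmonic: "lattice_harmonic_on (- Hset) decay_const"
proof (rule lattice_harmonic_onI)
  fix s assume off_slit: "s \<in> - Hset"
  let ?F = "\<lambda>x s. (1 - hit_gf x s) / fps_value sqrt_fps x"
  have "eventually (\<lambda>x. neighbour_mean (?F x) s = ?F x s) (at_left 1)"
    using eventually_at_left_1
  proof eventually_elim
    case (elim x)
    have "neighbour_mean (?F x) s = (1 - neighbour_mean (hit_gf x) s) / fps_value sqrt_fps x"
      by (cases s) (simp add: add_divide_distrib diff_divide_distrib algebra_simps)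
    then show ?case using lattice_harmonic_onD[OF hit_gf_harmonic off_slit] elim by simp
  qed
  with tendsto_neighbour_mean[OF decay_const_tendsto]
  have "((\<lambda>x. ?F x s) \<longlongrightarrow> neighbour_mean decay_const s) (at_left 1)"
    by (rule Lim_transform_eventually)
  then show "decay_const s = neighbour_mean decay_const s"
    by (intro tendsto_unique[OF _ decay_const_tendsto]) simp
qed

lemma nonneg_harmonic_eq_0_at_1_0:
  fixes F :: "int \<times> int \<Rightarrow> real"
  assumes nonneg: "\<And>s. 0 \<le> F s" and harmonic: "lattice_harmonic_on (- Hset) F"
    and "(i, j) \<notin> Hset" "F (i, j) = 0"
  shows "F (1, 0) = 0"
  using assms(3,4)
proof (induction "nat (\<bar>i - 1\<bar> + \<bar>j\<bar>)" arbitrary: i j rule: less_induct)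
  case less
  have "neighbour_mean F (i, j) = 0"
    using lattice_harmonic_onD[OF harmonic, of "(i, j)"] less.prems by simp
  then have spread: "F (i + 1, j) = 0" "F (i - 1, j) = 0" "F (i, j + 1) = 0" "F (i, j - 1) = 0"
    using nonneg[of "(i + 1, j)"] nonneg[of "(i - 1, j)"] nonneg[of "(i, j + 1)"] nonneg[of "(i, j - 1)"]
    by simp_all
  consider (right) "i > 1" | (left) "i < 1" "j \<noteq> 0" | (above) "i = 1" "j > 0" | (below) "i = 1" "j < 0"
    | (target) "i = 1" "j = 0"
    using less.prems(1) unfolding mem_Hset_iff by linarith
  then show ?case
  proof cases
    case right
    then show ?thesis by (intro less.hyps[OF _ _ spread(2)]) (auto simp: mem_Hset_iff)
  next
    case left
    then show ?thesis by (intro less.hyps[OF _ _ spread(1)]) (auto simp: mem_Hset_iff)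
  next
    case above
    then show ?thesis by (intro less.hyps[OF _ _ spread(4)]) (auto simp: mem_Hset_iff)
  next
    case below
    then show ?thesis by (intro less.hyps[OF _ _ spread(3)]) (auto simp: mem_Hset_iff)
  next
    case target
    then show ?thesis using less.prems(2) by simp
  qed
qed

lemma decay_const_nonzero:
  assumes "(i, j) \<notin> Hset"
  shows "decay_const (i, j) \<noteq> 0"
proof
  assume "decay_const (i, j) = 0"
  then have "decay_const (1, 0) = 0"
    by (rule nonneg_harmonic_eq_0_at_1_0[OF decay_const_nonneg decay_const_harmonic assms])
  moreover have "decay_const (1, 0) = 1" using decay_const_eq[OF laurent_sqrt_repr_hit_fps_1_0] by simp
  ultimately show False by simp
qed


section \<open>Asymptotics\<close>

lemma laurent_sqrt_repr_coeff_limit: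
  assumes repr: "laurent_sqrt_repr N P Q f"
  shows "(\<lambda>k. f $ k * real k powr (3/2)) \<longlonglongrightarrow> poly Q 1 * sqrt ((sqrt 2 - 1) / (2 * pi))"
proof -
  define c where "c = sqrt ((sqrt 2 - 1) / (2 * pi))"
  define g where "g = sqrt_fps * fps_of_poly Q"
  have "(\<lambda>n. g $ n * real (n + 1) powr (3/2)) \<longlonglongrightarrow> - c * fps_value (fps_of_poly Q) 1"
    unfolding g_def c_def
    by (rule fps_mult_weighted_limit[OF sqrt_fps_coeff_limit _ fps_abs_conv_of_poly[of Q 2]]) simp_all
  then have "(\<lambda>n. g $ n * real (n + 1) powr (3/2)) \<longlonglongrightarrow> - c * poly Q 1"
    by (simp add: fps_value_of_poly map_poly_of_real_real)
  then have "(\<lambda>k. g $ (k + N) * real (k + N + 1) powr (3/2)) \<longlonglongrightarrow> - c * poly Q 1"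
    by (rule LIMSEQ_ignore_initial_segment)
  moreover have "(\<lambda>k. (real k / real (k + N + 1)) powr (3/2)) \<longlonglongrightarrow> 1 powr (3/2)"
  proof (intro tendsto_powr tendsto_const)
    show "(\<lambda>k. real k / real (k + N + 1)) \<longlonglongrightarrow> 1" by real_asymp
  qed simp
  ultimately have "(\<lambda>k. - (g $ (k + N) * real (k + N + 1) powr (3/2)) * (real k / real (k + N + 1)) powr (3/2))
    \<longlonglongrightarrow> - (- c * poly Q 1) * 1 powr (3/2)"
    by (intro tendsto_mult[OF tendsto_minus])
  moreover have "eventually
    (\<lambda>k. - (g $ (k + N) * real (k + N + 1) powr (3/2)) * (real k / real (k + N + 1)) powr (3/2)
    = f $ k * real k powr (3/2)) sequentially"
    using eventually_gt_at_top[of "degree P"]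
  proof eventually_elim
    case (elim k)
    have "f $ k = (fps_X ^ N * f) $ (k + N)" by (simp add: fps_X_power_mult_nth)
    also have "\<dots> = (fps_of_poly P - g) $ (k + N)"
      using repr by (simp only: laurent_sqrt_repr_def g_def mult.commute)
    also have "\<dots> = - (g $ (k + N))" using elim by (simp add: coeff_eq_0)
    finally have "f $ k = - (g $ (k + N))" .
    moreover have "real (k + N + 1) powr (3/2) * (real k / real (k + N + 1)) powr (3/2) = real k powr (3/2)"
      by (subst powr_mult[symmetric]) auto
    ultimately show ?case by (simp only: mult.assoc mult_minus_left)
  qed
  ultimately show ?thesis by (simp add: Lim_transform_eventually c_def mult.commute)
qed

lemma telescoping_tail_le:
  fixes a b :: "nat \<Rightarrow> real"
  assumes "summable a" "b \<longlonglongrightarrow> 0" and term_le: "\<And>l. l \<ge> k \<Longrightarrow> c * (b l - b (Suc l)) \<le> a l"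
  shows "c * b k \<le> (\<Sum>l. a (l + k))"
proof -
  have "(\<lambda>l. b (l + k) - b (Suc l + k)) sums (b (0 + k) - 0)"
    by (rule telescope_sums') (rule LIMSEQ_ignore_initial_segment[OF assms(2)])
  then have "(\<lambda>l. c * (b (l + k) - b (Suc l + k))) sums (c * (b (0 + k) - 0))" by (rule sums_mult)
  moreover have "(\<lambda>l. a (l + k)) sums (\<Sum>l. a (l + k))"
    using assms(1) by (intro summable_sums summable_ignore_initial_segment)
  ultimately have "c * (b (0 + k) - 0) \<le> (\<Sum>l. a (l + k))"
    by (rule sums_le[rotated]) (use term_le[of "_ + k"] in simp)
  then show ?thesis by simp
qed

lemma eventually_less_tail_sum_ratio:
  fixes a b :: "nat \<Rightarrow> real"
  assumes "summable a" "b \<longlonglongrightarrow> 0" and decreasing: "eventually (\<lambda>k. b (Suc k) < b k \<and> 0 < b k) sequentially"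
    and lim: "(\<lambda>k. a k / (b k - b (Suc k))) \<longlonglongrightarrow> L" and "u < L"
  shows "eventually (\<lambda>k. u < (\<Sum>l. a (l + k)) / b k) sequentially"
proof -
  obtain c where "u < c" "c < L" using dense[OF \<open>u < L\<close>] by blast
  from decreasing order_tendstoD(1)[OF lim \<open>c < L\<close>]
  have "eventually (\<lambda>k. c * (b k - b (Suc k)) \<le> a k \<and> 0 < b k) sequentially"
    by eventually_elim (auto simp: pos_less_divide_eq)
  then obtain K where term_le: "\<And>k. k \<ge> K \<Longrightarrow> c * (b k - b (Suc k)) \<le> a k" and pos: "\<And>k. k \<ge> K \<Longrightarrow> 0 < b k"
    by (auto simp: eventually_sequentially)
  have "u < (\<Sum>l. a (l + k)) / b k" if "k \<ge> K" for k
  proof -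
    have "c * b k \<le> (\<Sum>l. a (l + k))"
      by (rule telescoping_tail_le[OF assms(1,2)]) (use term_le that in auto)
    then have "c \<le> (\<Sum>l. a (l + k)) / b k" using pos[OF that] by (simp add: pos_le_divide_eq)
    then show ?thesis using \<open>u < c\<close> by simp
  qed
  then show ?thesis by (auto simp: eventually_sequentially)
qed

lemma stolz_cesaro_tail_sum:
  fixes a b :: "nat \<Rightarrow> real"
  assumes summable: "summable a" and b_tendsto: "b \<longlonglongrightarrow> 0"
    and decreasing: "eventually (\<lambda>k. b (Suc k) < b k \<and> 0 < b k) sequentially"
    and lim: "(\<lambda>k. a k / (b k - b (Suc k))) \<longlonglongrightarrow> L"
  shows "(\<lambda>k. (\<Sum>l. a (l + k)) / b k) \<longlonglongrightarrow> L"
proof (rule order_tendstoI)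
  show "eventually (\<lambda>k. u < (\<Sum>l. a (l + k)) / b k) sequentially" if "u < L" for u
    by (rule eventually_less_tail_sum_ratio[OF summable b_tendsto decreasing lim that])
  show "eventually (\<lambda>k. (\<Sum>l. a (l + k)) / b k < u) sequentially" if "L < u" for u
  proof -
    have "(\<lambda>k. - a k / (b k - b (Suc k))) \<longlonglongrightarrow> - L" using tendsto_minus[OF lim] by simp
    then have "eventually (\<lambda>k. - u < (\<Sum>l. - a (l + k)) / b k) sequentially"
      using summable that
      by (intro eventually_less_tail_sum_ratio[OF _ b_tendsto decreasing]) (auto simp: summable_minus)
    then show ?thesis
      using summable by (simp add: suminf_minus summable_ignore_initial_segment)
  qed
qed

lemma tail_sum_powr_limit:
  fixes a :: "nat \<Rightarrow> real"
  assumes summable: "summable a" and "s > 1" and lim: "(\<lambda>k. a k * real k powr s) \<longlonglongrightarrow> L"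
  shows "(\<lambda>k. (\<Sum>l. a (l + k)) * real k powr (s - 1)) \<longlonglongrightarrow> L / (s - 1)"
proof -
  define b where "b k = real k powr (1 - s)" for k
  have "(\<lambda>k. (\<Sum>l. a (l + k)) / b k) \<longlonglongrightarrow> L / (s - 1)"
  proof (rule stolz_cesaro_tail_sum[OF summable])
    show "b \<longlonglongrightarrow> 0" unfolding b_def using \<open>s > 1\<close> by real_asymp
    show "eventually (\<lambda>k. b (Suc k) < b k \<and> 0 < b k) sequentially"
      using eventually_gt_at_top[of 0]
      by eventually_elim (use \<open>s > 1\<close> in \<open>auto simp: b_def intro!: powr_less_mono2_neg\<close>)
    have "(\<lambda>k. (b k - b (Suc k)) * real k powr s) \<longlonglongrightarrow> - (1 - s)" unfolding b_def using \<open>s > 1\<close> by real_asymp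
    then have "(\<lambda>k. (a k * real k powr s) / ((b k - b (Suc k)) * real k powr s)) \<longlonglongrightarrow> L / (- (1 - s))"
      using \<open>s > 1\<close> by (intro tendsto_divide lim) auto
    moreover have "eventually (\<lambda>k. (a k * real k powr s) / ((b k - b (Suc k)) * real k powr s)
        = a k / (b k - b (Suc k))) sequentially"
      using eventually_gt_at_top[of 0] by eventually_elim simp
    ultimately show "(\<lambda>k. a k / (b k - b (Suc k))) \<longlonglongrightarrow> L / (s - 1)" by (simp add: Lim_transform_eventually)
  qed
  moreover have "t / b k = t * real k powr (s - 1)" for t k
    using powr_minus_divide[of "real k" "s - 1"] by (simp add: b_def)
  ultimately show ?thesis by simp
qed

lemma asymp_equiv_powr:
  fixes f :: "nat \<Rightarrow> real"
  assumes "(\<lambda>k. f k * real k powr s) \<longlonglongrightarrow> c" "c \<noteq> 0"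
  shows "f \<sim>[at_top] (\<lambda>k. c * real k powr (- s))"
proof (rule asymp_equivI')
  have "(\<lambda>k. f k * real k powr s / c) \<longlonglongrightarrow> c / c" by (intro tendsto_divide assms tendsto_const)
  moreover have "f k * real k powr s / c = f k / (c * real k powr (- s))" for k
    by (simp add: powr_minus divide_simps)
  ultimately show "(\<lambda>k. f k / (c * real k powr (- s))) \<longlonglongrightarrow> 1" using assms(2) by simp
qed

lemma summable_hitp: "summable (hitp i j)"
  using summable_hit_fps[of "(i, j)"] by (simp add: hit_fps_nth)

lemma hitp_limit:
  assumes "laurent_sqrt_repr N P Q (hit_fps (i, j))"
  shows "(\<lambda>k. hitp i j k * real k powr (3/2)) \<longlonglongrightarrow> poly Q 1 * sqrt ((sqrt 2 - 1) / (2 * pi))"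
  using laurent_sqrt_repr_coeff_limit[OF assms] by (simp add: hit_fps_nth)

lemma hitp_asymp_equiv:
  assumes "laurent_sqrt_repr N P Q (hit_fps (i, j))" "poly Q 1 \<noteq> 0"
  shows "hitp i j \<sim>[at_top] (\<lambda>k. poly Q 1 * sqrt ((sqrt 2 - 1) / (2 * pi)) * real k powr (-3/2))"
  using asymp_equiv_powr[OF hitp_limit[OF assms(1)]] assms(2) by simp

lemma hitp_tail_asymp_equiv:
  assumes "laurent_sqrt_repr N P Q (hit_fps (i, j))" "poly Q 1 \<noteq> 0"
  shows "(\<lambda>k. \<Sum>l. hitp i j (l + k)) \<sim>[at_top]
    (\<lambda>k. poly Q 1 * sqrt (2 * (sqrt 2 - 1) / pi) * real k powr (-1/2))"
proof -
  define c where "c = (sqrt 2 - 1) / (2 * pi)"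
  have "sqrt 4 * sqrt c = sqrt (2 * (sqrt 2 - 1) / pi)"
    unfolding c_def real_sqrt_mult[symmetric] by (simp add: field_simps)
  then have const: "poly Q 1 * sqrt c / (3/2 - 1) = poly Q 1 * sqrt (2 * (sqrt 2 - 1) / pi)" by simp
  have "(\<lambda>k. (\<Sum>l. hitp i j (l + k)) * real k powr (3/2 - 1)) \<longlonglongrightarrow> poly Q 1 * sqrt (2 * (sqrt 2 - 1) / pi)"
    unfolding const[symmetric] c_def by (intro tail_sum_powr_limit summable_hitp hitp_limit[OF assms(1)]) simp
  from asymp_equiv_powr[OF this] show ?thesis using assms(2) by simp
qed

lemma hitp_sums:
  fixes z :: complex
  assumes repr: "laurent_sqrt_repr N P Q (hit_fps (i, j))" and "z \<noteq> 0" and norm_le: "norm z \<le> 1"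
  shows "(\<lambda>k. of_real (hitp i j k) * z ^ k) sums
    (laurent_eval (- int N) P z
      - laurent_eval (- int N) Q z * csqrt ((1 - z) * (1 - z * of_real ((sqrt 2 - 1)\<^sup>2))))"
proof -
  define F where "F = fps_value (hit_fps (i, j)) z"
  have conv: "fps_abs_conv (hit_fps (i, j)) z" by (rule fps_abs_conv_hit_fps[OF norm_le])
  have "z ^ N * F = poly (map_poly of_real P) z - poly (map_poly of_real Q) z * fps_value sqrt_fps z"
    unfolding F_def by (rule laurent_sqrt_repr_value[OF repr conv norm_le])
  then have "F = (poly (map_poly of_real P) z - poly (map_poly of_real Q) z * fps_value sqrt_fps z) / z ^ N"
    using \<open>z \<noteq> 0\<close> by (simp add: field_simps)
  also have "\<dots> = laurent_eval (- int N) P z - laurent_eval (- int N) Q z * fps_value sqrt_fps z"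
    by (simp add: laurent_eval_def power_int_minus divide_inverse algebra_simps)
  finally show ?thesis
    using fps_value_sums[OF conv] norm_le by (simp add: F_def hit_fps_nth fps_value_sqrt_fps alpha_def)
qed

lemma hit_fps_laurent_sqrt_reprE:
  obtains N P Q where "laurent_sqrt_repr N P Q (hit_fps (i, j))" "poly P 1 = 1"
    "(i, j) = (1, 0) \<longrightarrow> N = 1 \<and> P = 1 \<and> Q = 1"
proof (cases "(i, j) = (1, 0)")
  case True
  then show thesis using that[of 1 1 1] laurent_sqrt_repr_hit_fps_1_0 by simp
next
  case False
  then show thesis
    using that has_laurent_sqrt_repr_hit_fps[of i j] unfolding has_laurent_sqrt_repr_def by blast
qed

lemma laurent_eval_at_1: "laurent_eval m P (1 :: real) = poly P 1"
  by (simp add: laurent_eval_def map_poly_of_real_real)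

lemma laurent_eval_inverse: "laurent_eval (- 1) 1 z = 1 / z"
  by (simp add: laurent_eval_def power_int_minus divide_inverse map_poly_1)

theorem mainTheorem17:
  fixes i j :: int
  assumes "(i, j) \<notin> Hset"
  shows "\<exists>mf P mg Q.
     (\<forall>n. coeff P n \<in> \<rat>) \<and> (\<forall>n. coeff Q n \<in> QSqrt2) \<and>
     laurent_eval mf P (1::real) = 1 \<and> laurent_eval mg Q (1::real) \<noteq> 0 \<and>
     (\<forall>z::complex. z \<noteq> 0 \<and> norm z \<le> 1 \<longrightarrow>
        (\<lambda>k. complex_of_real (hitp i j k) * z ^ k) sums
          (laurent_eval mf P z - laurent_eval mg Q z *
             csqrt ((1 - z) * (1 - z * complex_of_real ((sqrt 2 - 1)^2))))) \<and>
     (\<lambda>k. hitp i j k) \<sim>[at_top]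
        (\<lambda>k. laurent_eval mg Q (1::real) * sqrt ((sqrt 2 - 1) / (2 * pi)) * real k powr (-3/2)) \<and>
     (\<lambda>k. \<Sum>l. hitp i j (l + k)) \<sim>[at_top]
        (\<lambda>k. laurent_eval mg Q (1::real) * sqrt (2 * (sqrt 2 - 1) / pi) * real k powr (-1/2)) \<and>
     ((i, j) = (1, 0) \<longrightarrow>
        (\<forall>z::complex. z \<noteq> 0 \<longrightarrow> laurent_eval mf P z = 1 / z \<and> laurent_eval mg Q z = 1 / z))"
proof -
  obtain N P Q where repr: "laurent_sqrt_repr N P Q (hit_fps (i, j))" and P_1: "poly P 1 = 1"
    and special: "(i, j) = (1, 0) \<longrightarrow> N = 1 \<and> P = 1 \<and> Q = 1"
    by (rule hit_fps_laurent_sqrt_reprE)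
  have Q_1: "poly Q 1 \<noteq> 0"
    using decay_const_nonzero[OF assms] decay_const_eq[OF repr P_1] by simp
  have coeffs: "\<forall>n. coeff P n \<in> \<rat>" "\<forall>n. coeff Q n \<in> QSqrt2"
    using repr by (simp_all add: laurent_sqrt_repr_def)
  have inverse: "\<forall>z::complex. z \<noteq> 0 \<longrightarrow> laurent_eval (- int N) P z = 1 / z \<and> laurent_eval (- int N) Q z = 1 / z"
    if "(i, j) = (1, 0)"
    using special that by (simp add: laurent_eval_inverse)
  show ?thesis
    by (rule exI[of _ "- int N"], rule exI[of _ P], rule exI[of _ "- int N"], rule exI[of _ Q],
        unfold laurent_eval_at_1)
      (use coeffs P_1 Q_1 hitp_sums[OF repr] hitp_asymp_equiv[OF repr Q_1]
        hitp_tail_asymp_equiv[OF repr Q_1] inverse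
        in blast)
qed

end
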